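(* Let $N\in\mathbb{N}$ and let the complex numbers $a_{0},\ldots ,a_{N}$ and $b_{1},\ldots ,b_{N}$ be such that $$\left\vert \frac{h}{2}+\frac{1}{4}\int_{0}^{x}q(s)\,ds-\sum_{n=0}^{N}a_{n}\mathbf{c}_{n}(x)\right\vert <\varepsilon _{1}$$ and $$\left\vert \frac{1}{4}\int_{0}^{x}q(s)\,ds-\sum_{n=1}^{N}b_{n}\mathbf{s}_{n}(x)\right\vert <\varepsilon _{2}$$ for every $x\in [-b,b]$. Then the kernel $\mathbf{K}_{f}(x,t)$ is approximated by the function $$K_{f,N}(x,t)=a_{0}u_{0}(x,t)+\sum_{n=1}^{N}a_{n}u_{2n-1}(x,t)+\sum_{n=1}^{N}b_{n}u_{2n}(x,t)$$ in such a way that for every $(x,t)\in \overline{\mathbf{S}}$ the inequality $$\bigl|\mathbf{K}_{f}(x,t)-K_{f,N}(x,t)\bigr|\leq 3\,\Vert T_{f}\Vert \cdot \Vert T_{G}^{-1}\Vert\, (\varepsilon _{1}+\varepsilon _{2})$$ holds.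
   Context: Setting. Let $b>0$, let $q:[-b,b]\to\mathbb{C}$ be continuous, and let $f\in C^{2}[-b,b]$ be a complex-valued solution of $f''-qf=0$ with $f(x)\neq 0$ on $[-b,b]$ and $f(0)=1$. Put $h:=f'(0)\in\mathbb{C}$. Let $\overline{\mathbf{S}}=[-b,b]\times[-b,b]$ be the closed square in the $(x,t)$-plane with a diagonal joining $(b,b)$ and $(-b,-b)$. Recursive integrals: $X^{(0)}\equiv \widetilde X^{(0)}\equiv 1$ and, for $n\ge 1$, $$X^{(n)}(x)=n\int_{0}^{x}X^{(n-1)}(s)\bigl(f^{2}(s)\bigr)^{(-1)^{n}}ds,\qquad \widetilde X^{(n)}(x)=n\int_{0}^{x}\widetilde X^{(n-1)}(s)\bigl(f^{2}(s)\bigr)^{(-1)^{n-1}}ds .$$ Put $\varphi_k(x)=f(x)X^{(k)}(x)$ for $k$ odd and $\varphi_k(x)=f(x)\widetilde X^{(k)}(x)$ for $k$ even. Generalized wave polynomials: $u_{0}(x,t)=\varphi_{0}(x)$ and, for $m\ge1$, $$u_{2m-1}(x,t)=\sum_{\substack{0\le k\le m\\ k\text{ even}}}\binom{m}{k}\varphi_{m-k}(x)t^{k},\qquad u_{2m}(x,t)=\sum_{\substack{1\le k\le m\\ k\text{ odd}}}\binom{m}{k}\varphi_{m-k}(x)t^{k}.$$ Traces: $\mathbf{c}_{0}(x)=u_0(x,x)=f(x)$, $\mathbf{c}_{m}(x)=u_{2m-1}(x,x)$ and $\mathbf{s}_{m}(x)=u_{2m}(x,x)$ for $m\ge 1$.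 Kernel: $\mathbf{K}_{f}(x,t)=\mathbf{H}\bigl(\tfrac{x+t}{2},\tfrac{x-t}{2}\bigr)$, where $\mathbf{H}$ is the unique solution of the Goursat problem $$\frac{\partial^{2}\mathbf{H}(u,v)}{\partial u\,\partial v}=q(u+v)\mathbf{H}(u,v),\qquad \mathbf{H}(u,0)=\frac h2+\frac12\int_0^u q(s)\,ds,\qquad \mathbf{H}(0,v)=\frac h2,$$ considered for all $(u,v)$ with $|u+v|\le b$, $|u-v|\le b$, so that $\mathbf{K}_f$ is defined on $\overline{\mathbf{S}}$. Operators: $T_f u(x)=u(x)+\int_{-x}^{x}\mathbf{K}_f(x,t)u(t)\,dt$ on $C[-b,b]$ with the maximum norm; $\|T_f\|$ is its operator norm. $V$ is the linear space of pairs $(\varphi,\psi)\in C^1[-b,b]\times C^1[-b,b]$ with $\varphi(0)=\psi(0)$, equipped with the maximum norm $\max(\max|\varphi|,\max|\psi|)$. $T_G:V\to V$ is the operator mapping the Goursat data $(\widetilde u(x,x),\widetilde u(x,-x))$ of a solution of $(\partial_x^2-\partial_t^2)\widetilde u=0$ in $\overline{\mathbf{S}}$ to the Goursat data $(u(x,x),u(x,-x))$ of $u=T_f\widetilde u$ ($T_f$ acting in the variable $x$), which solves $(\partial_x^2-\partial_t^2-q(x))u=0$. Explicitly, $T_G(\varphi,\psi)=(\Phi_1,\Phi_2)$ with $$\Phi_1(x)=\varphi(x)+2\int_0^x\mathbf{K}_f(x,2t-x)\varphi(t)dt+\psi(0)+2\int_{-x}^0\mathbf{K}_f(x,2t+x)\psi(t)dt-\varphi(0)f(x),$$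 $$\Phi_2(x)=\varphi(0)+2\int_{-x}^0\mathbf{K}_f(x,2t+x)\varphi(t)dt+\psi(x)+2\int_0^x\mathbf{K}_f(x,2t-x)\psi(t)dt-\varphi(0)f(x).$$ $T_G$ is known to be invertible on $V$ with $T_G$ and $T_G^{-1}$ bounded; $\|T_G^{-1}\|$ is the operator norm of the inverse. *)

theory Defs
  imports "HOL-Analysis.Analysis"
begin

text \<open>
  Functions on the interval from -b to b are total functions of type
  \<open>real \<Rightarrow> complex\<close> of which only the values on \<open>{-b..b}\<close> are used. Where such functions
  are points of a normed space (domain and range of an operator), they are taken in
  \<open>extensional {-b..b}\<close>, so that equality of points is equality on \<open>{-b..b}\<close>.
  All integrals \<open>LBINT s=a..c. g s\<close> are oriented, so a lower limit above the upper one is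
  meaningful.
\<close>

primrec X_int :: "(real \<Rightarrow> complex) \<Rightarrow> nat \<Rightarrow> real \<Rightarrow> complex" where
  "X_int f 0 = (\<lambda>x. 1)"
| "X_int f (Suc n) = (\<lambda>x. of_nat (Suc n) *
     (LBINT s=0..x. X_int f n s * ((f s)\<^sup>2) powi ((-1) ^ Suc n)))"

primrec X_tilde :: "(real \<Rightarrow> complex) \<Rightarrow> nat \<Rightarrow> real \<Rightarrow> complex" where
  "X_tilde f 0 = (\<lambda>x. 1)"
| "X_tilde f (Suc n) = (\<lambda>x. of_nat (Suc n) *
     (LBINT s=0..x. X_tilde f n s * ((f s)\<^sup>2) powi ((-1) ^ n)))"

definition phi :: "(real \<Rightarrow> complex) \<Rightarrow> nat \<Rightarrow> real \<Rightarrow> complex" where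
  "phi f k x = f x * (if odd k then X_int f k x else X_tilde f k x)"

text \<open>Generalized wave polynomials: odd index \<open>2 * m - 1\<close> collects the even powers of \<open>t\<close>,
  even index \<open>2 * m\<close> the odd ones.\<close>

definition wave_poly :: "(real \<Rightarrow> complex) \<Rightarrow> nat \<Rightarrow> real \<Rightarrow> real \<Rightarrow> complex" where
  "wave_poly f n x t =
    (if n = 0 then phi f 0 x
     else if odd n then
       (let m = (n + 1) div 2 in
         \<Sum>k | k \<le> m \<and> even k. of_nat (m choose k) * phi f (m - k) x * of_real t ^ k)
     else
       (let m = n div 2 in
         \<Sum>k | 1 \<le> k \<and> k \<le> m \<and> odd k. of_nat (m choose k) * phi f (m - k) x * of_real t ^ k))"

definition c_trace :: "(real \<Rightarrow> complex) \<Rightarrow> nat \<Rightarrow> real \<Rightarrow> complex" where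
  "c_trace f m x = (if m = 0 then wave_poly f 0 x x else wave_poly f (2 * m - 1) x x)"

definition s_trace :: "(real \<Rightarrow> complex) \<Rightarrow> nat \<Rightarrow> real \<Rightarrow> complex" where
  "s_trace f m x = wave_poly f (2 * m) x x"

text \<open>The Goursat problem in characteristic coordinates. The equation is required in the open
  square; a solution is continuous up to the boundary. No further regularity is demanded: these
  conditions already determine \<open>H\<close> on the closed square.\<close>

definition goursat_solution ::
    "real \<Rightarrow> (real \<Rightarrow> complex) \<Rightarrow> complex \<Rightarrow> (real \<Rightarrow> real \<Rightarrow> complex) \<Rightarrow> bool" where
  "goursat_solution b q h H \<longleftrightarrow>
     continuous_on {(u, v). \<bar>u + v\<bar> \<le> b \<and> \<bar>u - v\<bar> \<le> b} (\<lambda>(u, v). H u v) \<and>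
     (\<exists>H\<^sub>v. \<forall>u v. \<bar>u + v\<bar> < b \<and> \<bar>u - v\<bar> < b \<longrightarrow>
        ((\<lambda>y. H u y) has_vector_derivative H\<^sub>v u v) (at v) \<and>
        ((\<lambda>y. H\<^sub>v y v) has_vector_derivative q (u + v) * H u v) (at u)) \<and>
     (\<forall>u\<in>{-b..b}. H u 0 = h / 2 + 1 / 2 * (LBINT s=0..u. q s)) \<and>
     (\<forall>v\<in>{-b..b}. H 0 v = h / 2)"

definition K_kernel :: "(real \<Rightarrow> real \<Rightarrow> complex) \<Rightarrow> real \<Rightarrow> real \<Rightarrow> complex" where
  "K_kernel H x t = H ((x + t) / 2) ((x - t) / 2)"

definition C_space :: "real \<Rightarrow> (real \<Rightarrow> complex) set" where
  "C_space b = {g \<in> extensional {-b..b}. continuous_on {-b..b} g}"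

text \<open>The derivative is one-sided at the end points, hence not
  \<^const>\<open>C1_differentiable_on\<close>, which uses two-sided derivatives.\<close>

definition C1_space :: "real \<Rightarrow> (real \<Rightarrow> complex) set" where
  "C1_space b = {g \<in> extensional {-b..b}. \<exists>g'. continuous_on {-b..b} g' \<and>
     (\<forall>x\<in>{-b..b}. (g has_vector_derivative g' x) (at x within {-b..b}))}"

definition max_norm :: "real \<Rightarrow> (real \<Rightarrow> complex) \<Rightarrow> real" where
  "max_norm b g = (SUP x\<in>{-b..b}. norm (g x))"

definition V_space :: "real \<Rightarrow> ((real \<Rightarrow> complex) \<times> (real \<Rightarrow> complex)) set" where
  "V_space b = {(\<phi>, \<psi>). \<phi> \<in> C1_space b \<and> \<psi> \<in> C1_space b \<and> \<phi> 0 = \<psi> 0}"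

definition pair_norm :: "real \<Rightarrow> (real \<Rightarrow> complex) \<times> (real \<Rightarrow> complex) \<Rightarrow> real" where
  "pair_norm b w = max (max_norm b (fst w)) (max_norm b (snd w))"

text \<open>Operator norm of \<open>T\<close> on the space \<open>S\<close> with norm \<open>N\<close>; unlike \<^const>\<open>onorm\<close>, the
  space is a set rather than a type.\<close>

definition op_norm :: "('a \<Rightarrow> real) \<Rightarrow> 'a set \<Rightarrow> ('a \<Rightarrow> 'a) \<Rightarrow> real" where
  "op_norm N S T = (SUP w\<in>{w \<in> S. N w \<le> 1}. N (T w))"

definition T_f :: "real \<Rightarrow> (real \<Rightarrow> real \<Rightarrow> complex) \<Rightarrow> (real \<Rightarrow> complex) \<Rightarrow> real \<Rightarrow> complex" where
  "T_f b K u = (\<lambda>x\<in>{-b..b}. u x + (LBINT t=-x..x. K x t * u t))"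

text \<open>A solution of the wave equation with Goursat data \<open>\<phi>\<close>, \<open>\<psi>\<close> on \<open>t = x\<close>, \<open>t = -x\<close> is
  \<open>\<phi> ((x + t) / 2) + \<psi> ((x - t) / 2) - \<phi> 0\<close>. Applying \<open>T_f\<close> in \<open>x\<close>, using \<open>T_f 1 = f\<close>, and
  restricting to \<open>t = x\<close> and \<open>t = -x\<close> gives the two components.\<close>

definition T_G :: "real \<Rightarrow> (real \<Rightarrow> real \<Rightarrow> complex) \<Rightarrow> (real \<Rightarrow> complex) \<Rightarrow>
    (real \<Rightarrow> complex) \<times> (real \<Rightarrow> complex) \<Rightarrow> (real \<Rightarrow> complex) \<times> (real \<Rightarrow> complex)" where
  "T_G b K f = (\<lambda>(\<phi>, \<psi>).
    (\<lambda>x\<in>{-b..b}. \<phi> x + 2 * (LBINT t=0..x. K x (2 * t - x) * \<phi> t)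
        + \<psi> 0 + 2 * (LBINT t=-x..0. K x (2 * t + x) * \<psi> t) - \<phi> 0 * f x,
     \<lambda>x\<in>{-b..b}. \<phi> 0 + 2 * (LBINT t=-x..0. K x (2 * t + x) * \<phi> t)
        + \<psi> x + 2 * (LBINT t=0..x. K x (2 * t - x) * \<psi> t) - \<phi> 0 * f x))"

text \<open>\<open>T_G b K f\<close> is a bijection of \<open>V_space b\<close> onto itself for the data considered here, so that
  \<^const>\<open>inv_into\<close> is its genuine inverse.\<close>

definition T_G_inv :: "real \<Rightarrow> (real \<Rightarrow> real \<Rightarrow> complex) \<Rightarrow> (real \<Rightarrow> complex) \<Rightarrow>
    (real \<Rightarrow> complex) \<times> (real \<Rightarrow> complex) \<Rightarrow> (real \<Rightarrow> complex) \<times> (real \<Rightarrow> complex)" where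
  "T_G_inv b K f = inv_into (V_space b) (T_G b K f)"

definition K_approx :: "(real \<Rightarrow> complex) \<Rightarrow> nat \<Rightarrow> (nat \<Rightarrow> complex) \<Rightarrow> (nat \<Rightarrow> complex) \<Rightarrow>
    real \<Rightarrow> real \<Rightarrow> complex" where
  "K_approx f N \<alpha> \<beta> x t = \<alpha> 0 * wave_poly f 0 x t
     + (\<Sum>n=1..N. \<alpha> n * wave_poly f (2 * n - 1) x t)
     + (\<Sum>n=1..N. \<beta> n * wave_poly f (2 * n) x t)"

end

theory Submission
  imports Defs
begin

text \<open>
  In the characteristic coordinates \<open>u = (x + t) / 2\<close>, \<open>v = (x - t) / 2\<close> the kernel, the
  generalized wave polynomials and every function \<open>T\<^sub>f w\<close> with \<open>w (x, t) = \<phi> u + \<psi> v - \<phi> 0\<close> solve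
  \<open>\<partial>\<^sub>u\<partial>\<^sub>v U = q (u + v) U\<close>, and such a solution is determined by its values on the two axes.
  For the error \<open>D = K - K\<^sub>N\<close> these values are the sum and the difference of the two approximation
  errors, hence at most \<open>\<epsilon>\<^sub>1 + \<epsilon>\<^sub>2\<close>. With \<open>(\<phi>, \<psi>)\<close> the preimage of the data of \<open>D\<close> under \<open>T\<^sub>G\<close>,
  uniqueness gives \<open>D = T\<^sub>f w\<close>, and \<open>|w| \<le> |\<phi>| + |\<psi>| + |\<phi> 0|\<close> is the source of the factor 3.
  The inverse of \<open>T\<^sub>G\<close> exists and is bounded because the equations for \<open>\<phi> + \<psi>\<close> and \<open>\<phi> - \<psi>\<close>
  decouple into Volterra equations of the second kind.
\<close>

section \<open>Oriented integrals of continuous functions\<close>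

text \<open>\<open>op_norm\<close> is a supremum of reals, which bounds nothing unless the set is
  known to be bounded above. So although only norms enter the estimate, the proof has to show that
  \<open>T_f\<close> and the inverse of \<open>T_G\<close> are bounded, and that every element of
  \<open>V_space\<close> has a preimage there, since otherwise \<open>inv_into\<close> is an
  unspecified value. The preimage must be continuously differentiable, because the wave function
  belonging to \<open>\<psi>\<close> solves the equation in the required sense only if
  \<open>\<psi>\<close> has a derivative. A second obstacle is the weak notion of solution: a
  derivative in \<open>v\<close>, then one in \<open>u\<close>, both only inside the square and
  without any continuity. Uniqueness therefore rests on mean value estimates at inner points, and
  the kernel is replaced by an extension with continuous derivatives before any integral containing
  it is differentiated.\<close>

definition oint :: "real \<Rightarrow> real \<Rightarrow> (real \<Rightarrow> complex) \<Rightarrow> complex" where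
  "oint a b f = (LBINT r=ereal a..ereal b. f r)"

lemma cont_comp2:
  assumes "continuous_on UNIV (\<lambda>(u, v). F u v)" "continuous_on S a" "continuous_on S b"
  shows "continuous_on S (\<lambda>x. F (a x) (b x))"
  using continuous_on_compose2[OF assms(1), of S "\<lambda>x. (a x, b x)"] assms(2,3)
  by (auto intro!: continuous_intros)

lemma oint_deriv:
  assumes "continuous_on UNIV f"
  shows "((\<lambda>x. oint a x f) has_vector_derivative f x) (at x within S)"
proof -
  \<comment> \<open>The FTC needs one interval containing both \<open>a\<close> and
    \<open>x\<close>; the margin 1 makes \<open>x\<close> an inner point, where the derivative
    within the interval is the full derivative.\<close>
  define l u where "l = min a x - 1" and "u = max a x + 1"
  have "l < x" "x < u" unfolding l_def u_def by linarith+
  have "((\<lambda>x. LBINT y=a..x. f y) has_vector_derivative f x) (at x within {l..u})"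
    by (rule interval_integral_FTC2) (auto simp: l_def u_def intro: continuous_on_subset[OF assms])
  then have "((\<lambda>x. LBINT y=a..x. f y) has_vector_derivative f x) (at x within {l<..<u})"
    by (rule has_vector_derivative_within_subset) auto
  then have "((\<lambda>x. LBINT y=a..x. f y) has_vector_derivative f x) (at x)"
    using at_within_open[of x "{l<..<u}"] \<open>l < x\<close> \<open>x < u\<close> by simp
  then show ?thesis
    unfolding oint_def by (rule has_vector_derivative_at_within)
qed

lemma oint_FTC:
  assumes "continuous_on UNIV f" "\<And>x. (F has_vector_derivative f x) (at x)"
  shows "oint a b f = F b - F a"
  unfolding oint_def
  by (rule interval_integral_FTC_finite)
     (auto intro: continuous_on_subset[OF assms(1)] has_vector_derivative_at_within[OF assms(2)])

lemma oint_same [simp]: "oint a a f = 0"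
  by (simp add: oint_def interval_integral_eq_integral einterval_same)

lemma oint_split:
  assumes "continuous_on UNIV f"
  shows "oint a b f = oint c b f - oint c a f"
  using oint_FTC[OF assms oint_deriv[OF assms]] by blast

lemma oint_cong:
  assumes "\<And>r. min a b \<le> r \<Longrightarrow> r \<le> max a b \<Longrightarrow> f r = g r"
  shows "oint a b f = oint a b g"
  unfolding oint_def
  by (rule interval_integral_cong) (use assms in \<open>auto simp: min_def max_def split: if_splits\<close>)

lemma oint_add:
  assumes "continuous_on UNIV f" "continuous_on UNIV g"
  shows "oint a b (\<lambda>x. f x + g x) = oint a b f + oint a b g"
proof -
  have "oint a b (\<lambda>x. f x + g x) = (\<lambda>y. oint a y f + oint a y g) b - (\<lambda>y. oint a y f + oint a y g) a"
    by (rule oint_FTC) (auto intro!: continuous_intros assms derivative_intros oint_deriv)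
  then show ?thesis by simp
qed

lemma oint_cmult: "oint a b (\<lambda>x. c * f x) = c * oint a b f"
  by (simp add: oint_def)

lemma oint_diff:
  assumes "continuous_on UNIV f" "continuous_on UNIV g"
  shows "oint a b (\<lambda>x. f x - g x) = oint a b f - oint a b g"
  using oint_add[OF assms(1), of "\<lambda>x. -1 * g x" a b] oint_cmult[of a b "-1" g]
  by (simp add: assms continuous_on_minus)

text \<open>The substitution is proved through antiderivatives, so \<open>c\<close> may be zero or
  negative; \<open>oint_cont\<close> uses it with \<open>c = \<beta> p - \<alpha> p\<close>, whose
  sign is unknown.\<close>

lemma oint_affine:
  fixes c d :: real
  assumes "continuous_on UNIV f"
  shows "oint (c * a + d) (c * b + d) f = c * oint a b (\<lambda>r. f (c * r + d))"
proof -
  let ?F = "\<lambda>r. oint d (c * r + d) f"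
  have "oint a b (\<lambda>r. c *\<^sub>R f (c * r + d)) = ?F b - ?F a"
  proof (rule oint_FTC)
    show "continuous_on UNIV (\<lambda>r. c *\<^sub>R f (c * r + d))"
      by (intro continuous_intros continuous_on_compose2[OF assms]) auto
    fix x
    have "((\<lambda>r. c * r + d) has_vector_derivative c) (at x)"
      by (auto intro!: derivative_eq_intros)
    from vector_diff_chain_at[OF this oint_deriv[OF assms]]
    show "(?F has_vector_derivative c *\<^sub>R f (c * x + d)) (at x)"
      by (simp add: o_def)
  qed
  moreover have "?F b - ?F a = oint (c * a + d) (c * b + d) f"
    using oint_split[OF assms] by simp
  ultimately show ?thesis
    by (simp add: scaleR_conv_of_real oint_cmult)
qed

lemma oint_norm_le:
  assumes "continuous_on UNIV f" "\<And>r. min a b \<le> r \<Longrightarrow> r \<le> max a b \<Longrightarrow> norm (f r) \<le> M"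
  shows "norm (oint a b f) \<le> M * \<bar>b - a\<bar>"
proof -
  have "norm (oint a b f - oint a a f) \<le> M * norm (b - a)"
  proof (rule differentiable_bound[of "closed_segment a b" "\<lambda>x. oint a x f" "\<lambda>x r. r *\<^sub>R f x"])
    show "((\<lambda>x. oint a x f) has_derivative (\<lambda>r. r *\<^sub>R f x)) (at x within closed_segment a b)" for x
      using oint_deriv[OF assms(1)] by (simp add: has_vector_derivative_def)
    fix x assume "x \<in> closed_segment a b"
    then have "norm (f x) \<le> M"
      by (intro assms) (auto simp: closed_segment_eq_real_ivl split: if_splits)
    then show "onorm (\<lambda>r. r *\<^sub>R f x) \<le> M"
      by (simp add: onorm_scaleR_left onorm_id)
  qed auto
  then show ?thesis by simp
qed

text \<open>An affine substitution moves both limits to 0 and 1. What remains is a parameter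
  integral over a fixed compact interval.\<close>

lemma oint_cont:
  fixes F :: "'a::topological_space \<Rightarrow> real \<Rightarrow> complex"
  assumes F: "continuous_on (S \<times> UNIV) (\<lambda>(p, r). F p r)"
    and \<alpha>: "continuous_on S \<alpha>" and \<beta>: "continuous_on S \<beta>"
  shows "continuous_on S (\<lambda>p. oint (\<alpha> p) (\<beta> p) (F p))"
proof -
  have Fp: "continuous_on UNIV (F p)" if "p \<in> S" for p
    using continuous_on_compose2[OF F, of UNIV "\<lambda>r. (p, r)"] that
    by (simp add: continuous_intros image_subset_iff)
  have eq: "oint (\<alpha> p) (\<beta> p) (F p) =
      (\<beta> p - \<alpha> p) * integral (cbox 0 1) (\<lambda>r. F p ((\<beta> p - \<alpha> p) * r + \<alpha> p))" if "p \<in> S" for p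
  proof -
    have "oint (\<alpha> p) (\<beta> p) (F p) = (\<beta> p - \<alpha> p) * oint 0 1 (\<lambda>r. F p ((\<beta> p - \<alpha> p) * r + \<alpha> p))"
      using oint_affine[OF Fp[OF that], of "\<beta> p - \<alpha> p" 0 "\<alpha> p" 1] by simp
    also have "oint 0 1 (\<lambda>r. F p ((\<beta> p - \<alpha> p) * r + \<alpha> p)) =
        integral (cbox 0 1) (\<lambda>r. F p ((\<beta> p - \<alpha> p) * r + \<alpha> p))"
      unfolding oint_def interval_cbox[symmetric]
      by (intro interval_integral_eq_integral borel_integrable_atLeastAtMost' continuous_intros
          continuous_on_compose2[OF Fp[OF that]]) auto
    finally show ?thesis .
  qed
  have "continuous_on (S \<times> cbox 0 1) (\<lambda>(p, r). F p ((\<beta> p - \<alpha> p) * r + \<alpha> p))"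
  proof -
    have "continuous_on (S \<times> cbox 0 1) (\<lambda>z. (fst z, (\<beta> (fst z) - \<alpha> (fst z)) * snd z + \<alpha> (fst z)))"
      by (intro continuous_intros continuous_on_compose2[OF \<alpha>] continuous_on_compose2[OF \<beta>]) auto
    from continuous_on_compose2[OF F this] show ?thesis
      by (simp add: case_prod_beta image_subset_iff)
  qed
  from integral_continuous_on_param[OF this]
  have "continuous_on S (\<lambda>p. (\<beta> p - \<alpha> p) * integral (cbox 0 1) (\<lambda>r. F p ((\<beta> p - \<alpha> p) * r + \<alpha> p)))"
    by (intro continuous_intros \<alpha> \<beta>)
  then show ?thesis
    by (rule continuous_on_eq) (use eq in simp)
qed

lemma oint_cont_UNIV:
  fixes F :: "'a::topological_space \<Rightarrow> real \<Rightarrow> complex"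
  assumes "continuous_on UNIV (\<lambda>z. F (fst z) (snd z))" "continuous_on S \<alpha>" "continuous_on S \<beta>"
  shows "continuous_on S (\<lambda>p. oint (\<alpha> p) (\<beta> p) (F p))"
  using assms by (intro oint_cont) (auto simp: case_prod_beta intro: continuous_on_subset)

text \<open>With base point 0 the integral is a function of two variables, the parameter
  \<open>y\<close> and the upper limit \<open>z\<close>. It is jointly differentiable because its
  partial derivative in \<open>z\<close>, the integrand itself, is continuous. The chain rule along
  \<open>y \<mapsto> (y, \<gamma> y)\<close> for each of the two limits and a subtraction then give
  the formula.\<close>

lemma oint_leibniz:
  assumes F: "continuous_on UNIV (\<lambda>(y, r). F y r)" and F': "continuous_on UNIV (\<lambda>(y, r). F' y r)"
    and dF: "\<And>y r. ((\<lambda>y. F y r) has_vector_derivative F' y r) (at y)"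
    and \<alpha>: "(\<alpha> has_real_derivative \<alpha>') (at y)" and \<beta>: "(\<beta> has_real_derivative \<beta>') (at y)"
  shows "((\<lambda>y. oint (\<alpha> y) (\<beta> y) (F y)) has_vector_derivative
     \<beta>' *\<^sub>R F y (\<beta> y) - \<alpha>' *\<^sub>R F y (\<alpha> y) + oint (\<alpha> y) (\<beta> y) (F' y)) (at y)"
proof -
  have Fy: "continuous_on UNIV (F y)" and F'y: "continuous_on UNIV (F' y)" for y
    using cont_comp2[OF F, of UNIV "\<lambda>_. y" "\<lambda>r. r"] cont_comp2[OF F', of UNIV "\<lambda>_. y" "\<lambda>r. r"] by auto
  have J: "((\<lambda>(y, z). oint 0 z (F y)) has_derivative
      (\<lambda>(s, t). s *\<^sub>R oint 0 z (F' y) + t *\<^sub>R F y z)) (at (y, z))" for y z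
  proof -
    have *: "((\<lambda>y. oint 0 z (F y)) has_vector_derivative oint 0 z (F' y)) (at y)" for y z
    proof -
      \<comment> \<open>Differentiation under the integral is available over a fixed box, whereas
        \<open>z\<close> may be negative; hence the scaling to the unit interval.\<close>
      have eq: "oint 0 z g = z * integral (cbox 0 1) (\<lambda>r. g (z * r))" if "continuous_on UNIV g" for g :: "real \<Rightarrow> complex"
      proof -
        have "oint 0 z g = z * oint 0 1 (\<lambda>r. g (z * r))"
          using oint_affine[OF that, of z 0 0 1] by simp
        also have "oint 0 1 (\<lambda>r. g (z * r)) = integral (cbox 0 1) (\<lambda>r. g (z * r))"
          unfolding oint_def interval_cbox[symmetric]
          by (intro interval_integral_eq_integral borel_integrable_atLeastAtMost' continuous_intros
              continuous_on_compose2[OF that]) auto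
        finally show ?thesis .
      qed
      have "((\<lambda>y. integral (cbox 0 1) (\<lambda>r. F y (z * r))) has_vector_derivative
          integral (cbox 0 1) (\<lambda>r. F' y (z * r))) (at y within UNIV)"
      proof (rule leibniz_rule_vector_derivative)
        show "(\<lambda>r. F y (z * r)) integrable_on cbox 0 1" for y
          by (intro integrable_continuous continuous_on_compose2[OF Fy] continuous_intros) auto
        have "continuous_on (UNIV \<times> cbox 0 1) (\<lambda>p. F' (fst p) (z * snd p))"
          by (intro cont_comp2[OF F'] continuous_intros)
        then show "continuous_on (UNIV \<times> cbox 0 1) (\<lambda>(y, r). F' y (z * r))"
          by (simp add: case_prod_beta)
      qed (auto intro: dF)
      then show ?thesis
        unfolding eq[OF Fy] eq[OF F'y] by (auto intro!: derivative_eq_intros)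
    qed
    have "((\<lambda>(y, z). oint 0 z (F y)) has_derivative
      (\<lambda>(s, t). s *\<^sub>R oint 0 z (F' y) + blinfun_apply (blinfun_scaleR_left (F y z)) t)) (at (y, z) within UNIV \<times> UNIV)"
    proof (rule has_derivative_partialsI)
      show "((\<lambda>y. oint 0 z (F y)) has_derivative (\<lambda>s. s *\<^sub>R oint 0 z (F' y))) (at y)"
        using * by (simp add: has_vector_derivative_def)
      show "((\<lambda>z. oint 0 z (F y)) has_derivative blinfun_apply (blinfun_scaleR_left (F y z))) (at z)" for y z
        using oint_deriv[OF Fy, of 0 y z] by (simp add: has_vector_derivative_def)
      show "continuous (at (y, z) within UNIV \<times> UNIV) (\<lambda>(x, y). blinfun_scaleR_left (F x y))"
      proof -
        have "continuous_on (UNIV \<times> UNIV) (\<lambda>p. blinfun_scaleR_left (F (fst p) (snd p)))"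
          by (intro continuous_intros cont_comp2[OF F]) 
        then show ?thesis
          unfolding UNIV_Times_UNIV case_prod_beta by (simp add: continuous_on_eq_continuous_at)
      qed
    qed auto
    then show ?thesis by simp
  qed
  have chain: "((\<lambda>y. oint 0 (\<gamma> y) (F y)) has_vector_derivative
      (oint 0 (\<gamma> y) (F' y) + \<gamma>' *\<^sub>R F y (\<gamma> y))) (at y)"
    if "(\<gamma> has_real_derivative \<gamma>') (at y)" for \<gamma> \<gamma>'
  proof -
    have "((\<lambda>y. (y, \<gamma> y)) has_derivative (\<lambda>s. (s, \<gamma>' * s))) (at y)"
      using that by (auto intro!: has_derivative_Pair simp: has_field_derivative_def)
    from has_derivative_compose[OF this J] show ?thesis
      by (simp add: has_vector_derivative_def scaleR_add_right mult.commute)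
  qed
  have D: "((\<lambda>y. oint 0 (\<beta> y) (F y) - oint 0 (\<alpha> y) (F y)) has_vector_derivative
      (oint 0 (\<beta> y) (F' y) + \<beta>' *\<^sub>R F y (\<beta> y))
      - (oint 0 (\<alpha> y) (F' y) + \<alpha>' *\<^sub>R F y (\<alpha> y))) (at y)"
    by (intro derivative_intros chain \<alpha> \<beta>)
  have eq: "oint (\<alpha> z) (\<beta> z) (F z) = oint 0 (\<beta> z) (F z) - oint 0 (\<alpha> z) (F z)"
    "oint (\<alpha> z) (\<beta> z) (F' z) = oint 0 (\<beta> z) (F' z) - oint 0 (\<alpha> z) (F' z)" for z
    by (rule oint_split Fy F'y)+
  show ?thesis
    unfolding eq using D by (simp add: algebra_simps)
qed

lemma has_vector_derivative_comp_real:
  assumes "(f has_vector_derivative d) (at (g x))" "(g has_real_derivative c) (at x)"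
  shows "((\<lambda>x. f (g x)) has_vector_derivative c *\<^sub>R d) (at x)"
  using vector_diff_chain_at[of g c x f d] assms
  by (simp add: o_def has_real_derivative_iff_has_vector_derivative)

lemma has_vector_derivative_shift:
  fixes y r :: real
  shows "(f has_vector_derivative d) (at (r + y)) \<Longrightarrow> ((\<lambda>y. f (r + y)) has_vector_derivative d) (at y)"
    and "(f has_vector_derivative d) (at (y - r)) \<Longrightarrow> ((\<lambda>y. f (y - r)) has_vector_derivative d) (at y)"
proof -
  have "((\<lambda>y. r + y) has_real_derivative 1) (at y)" "((\<lambda>y. y - r) has_real_derivative 1) (at y)"
    by (auto intro!: derivative_eq_intros)
  then show "(f has_vector_derivative d) (at (r + y)) \<Longrightarrow> ((\<lambda>y. f (r + y)) has_vector_derivative d) (at y)"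
    and "(f has_vector_derivative d) (at (y - r)) \<Longrightarrow> ((\<lambda>y. f (y - r)) has_vector_derivative d) (at y)"
    using has_vector_derivative_comp_real[of f d "\<lambda>y. r + y" y 1]
      has_vector_derivative_comp_real[of f d "\<lambda>y. y - r" y 1] by auto
qed

section \<open>The equation in characteristic coordinates\<close>

text \<open>Integrating the weight \<open>exp (\<mu> * \<bar>t\<bar>)\<close> away from 0 gains a
  factor \<open>1 / \<mu>\<close>. This is the only source of smallness in the development:
  uniqueness, stability and solvability all draw on it. The weight is even in \<open>t\<close>, so
  one bound serves both sides of 0.\<close>

lemma exp_growth_bound:
  fixes g :: "real \<Rightarrow> complex"
  assumes \<mu>: "\<mu> > 0"
    and d: "\<And>t. \<bar>t\<bar> \<le> \<bar>x\<bar> \<Longrightarrow> (g has_vector_derivative g' t) (at t)"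
    and g': "\<And>t. \<bar>t\<bar> \<le> \<bar>x\<bar> \<Longrightarrow> norm (g' t) \<le> c * exp (\<mu> * \<bar>t\<bar>)"
  shows "norm (g x - g 0) \<le> c / \<mu> * exp (\<mu> * \<bar>x\<bar>)"
proof -
  have c: "c \<ge> 0"
    using g'[of 0] norm_ge_zero[of "g' 0"] by (simp del: norm_ge_zero)
  have pos: "norm (g y - g 0) \<le> c / \<mu> * exp (\<mu> * y)"
    if "y > 0" and d: "\<And>t. 0 \<le> t \<Longrightarrow> t \<le> y \<Longrightarrow> (g has_vector_derivative g' t) (at t)"
      and g': "\<And>t. 0 \<le> t \<Longrightarrow> t \<le> y \<Longrightarrow> norm (g' t) \<le> c * exp (\<mu> * t)"
    for g g' :: "real \<Rightarrow> complex" and y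
  proof -
    have "norm (g y - g 0) \<le> c / \<mu> * exp (\<mu> * y) - c / \<mu> * exp (\<mu> * 0)"
    proof (rule differentiable_bound_general[OF \<open>y > 0\<close>])
      show "continuous_on {0..y} g"
        by (auto intro!: continuous_at_imp_continuous_on has_vector_derivative_continuous d)
      show "((\<lambda>s. c / \<mu> * exp (\<mu> * s)) has_vector_derivative c * exp (\<mu> * s)) (at s)" for s
        using \<mu> by (auto intro!: derivative_eq_intros simp: has_real_derivative_iff_has_vector_derivative[symmetric])
    qed (use \<mu> in \<open>auto intro!: continuous_intros d g'\<close>)
    moreover have "c / \<mu> * exp (\<mu> * 0) \<ge> 0"
      using \<mu> c by simp
    ultimately show ?thesis by linarith
  qed
  consider "x = 0" | "x > 0" | "x < 0" by linarith
  then show ?thesis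
  proof cases
    case 1
    then show ?thesis using \<mu> c by simp
  next
    case 2
    have "norm (g x - g 0) \<le> c / \<mu> * exp (\<mu> * x)"
    proof (rule pos[of x g g'])
      fix t assume "0 \<le> t" "t \<le> x"
      with 2 show "(g has_vector_derivative g' t) (at t)" "norm (g' t) \<le> c * exp (\<mu> * t)"
        using d[of t] g'[of t] by auto
    qed (use 2 in auto)
    with 2 show ?thesis by simp
  next
    case 3
    have "((\<lambda>s. g (- s)) has_vector_derivative - g' (- t)) (at t)" if "0 \<le> t" "t \<le> - x" for t
    proof -
      have "((\<lambda>s. - s) has_vector_derivative (- 1 :: real)) (at t)"
        by (auto intro!: derivative_eq_intros)
      from vector_diff_chain_at[OF this, of g "g' (- t)"] d[of "- t"] that 3 show ?thesis
        by (simp add: o_def)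
    qed
    then have "norm (g (- (- x)) - g (- 0)) \<le> c / \<mu> * exp (\<mu> * - x)"
    proof (intro pos[of "- x" "\<lambda>s. g (- s)" "\<lambda>t. - g' (- t)"])
      fix t assume "0 \<le> t" "t \<le> - x"
      with 3 show "norm (- g' (- t)) \<le> c * exp (\<mu> * t)"
        using g'[of "- t"] by auto
    qed (use 3 in auto)
    with 3 show ?thesis by simp
  qed
qed

section \<open>Solutions on the closed diamond and their uniqueness\<close>

definition diamond :: "real \<Rightarrow> (real \<times> real) set" where
  "diamond b = {(u, v). \<bar>u + v\<bar> \<le> b \<and> \<bar>u - v\<bar> \<le> b}"

text \<open>In this form it is visible that the diamond contains, with \<open>(u, v)\<close>, the
  whole rectangle spanned by the origin and \<open>(u, v)\<close>, over which the mixed derivative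
  is integrated, as well as all multiples of \<open>(u, v)\<close> by factors between 0 and
  1.\<close>

lemma diamond_iff: "(u, v) \<in> diamond b \<longleftrightarrow> \<bar>u\<bar> + \<bar>v\<bar> \<le> b"
  by (auto simp: diamond_def)

lemma half_coords_in_diamond:
  assumes "x \<in> {-b..b}" "t \<in> {-b..b}"
  shows "((x + t) / 2, (x - t) / 2) \<in> diamond b"
proof -
  have "(x + t) / 2 + (x - t) / 2 = x" "(x + t) / 2 - (x - t) / 2 = t"
    by (simp_all add: field_simps)
  then show ?thesis using assms by (simp add: diamond_def) (simp add: abs_le_iff)
qed

text \<open>The part of \<open>goursat_solution\<close> that does not concern the data. The order of
  differentiation is fixed, so exchanging \<open>u\<close> and \<open>v\<close> is not an evident
  symmetry; functions transmuted in the second variable get a proof of their own.\<close>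

definition wave_sol :: "real \<Rightarrow> (real \<Rightarrow> complex) \<Rightarrow> (real \<Rightarrow> real \<Rightarrow> complex) \<Rightarrow> bool" where
  "wave_sol b q U \<longleftrightarrow> continuous_on (diamond b) (\<lambda>(u, v). U u v) \<and>
     (\<exists>U\<^sub>v. \<forall>u v. \<bar>u + v\<bar> < b \<and> \<bar>u - v\<bar> < b \<longrightarrow>
        ((\<lambda>y. U u y) has_vector_derivative U\<^sub>v u v) (at v) \<and>
        ((\<lambda>y. U\<^sub>v y v) has_vector_derivative q (u + v) * U u v) (at u))"

lemma open_diamond_iff: "\<bar>u + v\<bar> < b \<and> \<bar>u - v\<bar> < b \<longleftrightarrow> \<bar>u\<bar> + \<bar>v\<bar> < (b::real)"
  by auto

lemma wave_solI:
  assumes "continuous_on (diamond b) (\<lambda>(u, v). U u v)"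
    and "\<And>u v. \<bar>u\<bar> + \<bar>v\<bar> < b \<Longrightarrow> ((\<lambda>y. U u y) has_vector_derivative U\<^sub>v u v) (at v)"
    and "\<And>u v. \<bar>u\<bar> + \<bar>v\<bar> < b \<Longrightarrow> ((\<lambda>y. U\<^sub>v y v) has_vector_derivative q (u + v) * U u v) (at u)"
  shows "wave_sol b q U"
  unfolding wave_sol_def open_diamond_iff using assms by metis

lemma wave_solE:
  assumes "wave_sol b q U"
  obtains U\<^sub>v where "continuous_on (diamond b) (\<lambda>(u, v). U u v)"
    and "\<And>u v. \<bar>u\<bar> + \<bar>v\<bar> < b \<Longrightarrow> ((\<lambda>y. U u y) has_vector_derivative U\<^sub>v u v) (at v)"
    and "\<And>u v. \<bar>u\<bar> + \<bar>v\<bar> < b \<Longrightarrow> ((\<lambda>y. U\<^sub>v y v) has_vector_derivative q (u + v) * U u v) (at u)"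
  using assms that unfolding wave_sol_def open_diamond_iff by metis

lemma wave_sol_cmult:
  assumes "wave_sol b q U"
  shows "wave_sol b q (\<lambda>u v. c * U u v)"
proof -
  obtain U\<^sub>v where U: "continuous_on (diamond b) (\<lambda>(u, v). U u v)"
    "\<And>u v. \<bar>u\<bar> + \<bar>v\<bar> < b \<Longrightarrow> ((\<lambda>y. U u y) has_vector_derivative U\<^sub>v u v) (at v)"
    "\<And>u v. \<bar>u\<bar> + \<bar>v\<bar> < b \<Longrightarrow> ((\<lambda>y. U\<^sub>v y v) has_vector_derivative q (u + v) * U u v) (at u)"
    using wave_solE[OF assms] by metis
  show ?thesis
  proof (rule wave_solI[of _ _ "\<lambda>u v. c * U\<^sub>v u v"])
    show "continuous_on (diamond b) (\<lambda>(u, v). c * U u v)"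
      using continuous_on_mult_left[OF U(1), of c] by (simp add: case_prod_beta)
  qed (use has_vector_derivative_mult_right[OF U(2), of _ _ c] has_vector_derivative_mult_right[OF U(3), of _ _ c]
      in \<open>auto simp: mult.left_commute\<close>)
qed

lemma wave_sol_add:
  assumes "wave_sol b q U" "wave_sol b q W"
  shows "wave_sol b q (\<lambda>u v. U u v + W u v)"
proof -
  obtain U\<^sub>v where U: "continuous_on (diamond b) (\<lambda>(u, v). U u v)"
    "\<And>u v. \<bar>u\<bar> + \<bar>v\<bar> < b \<Longrightarrow> ((\<lambda>y. U u y) has_vector_derivative U\<^sub>v u v) (at v)"
    "\<And>u v. \<bar>u\<bar> + \<bar>v\<bar> < b \<Longrightarrow> ((\<lambda>y. U\<^sub>v y v) has_vector_derivative q (u + v) * U u v) (at u)"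
    using wave_solE[OF assms(1)] by metis
  obtain W\<^sub>v where W: "continuous_on (diamond b) (\<lambda>(u, v). W u v)"
    "\<And>u v. \<bar>u\<bar> + \<bar>v\<bar> < b \<Longrightarrow> ((\<lambda>y. W u y) has_vector_derivative W\<^sub>v u v) (at v)"
    "\<And>u v. \<bar>u\<bar> + \<bar>v\<bar> < b \<Longrightarrow> ((\<lambda>y. W\<^sub>v y v) has_vector_derivative q (u + v) * W u v) (at u)"
    using wave_solE[OF assms(2)] by metis
  show ?thesis
  proof (rule wave_solI[of _ _ "\<lambda>u v. U\<^sub>v u v + W\<^sub>v u v"])
    show "continuous_on (diamond b) (\<lambda>(u, v). U u v + W u v)"
      using continuous_on_add[OF U(1) W(1)] by (simp add: case_prod_beta)
  qed (use has_vector_derivative_add[OF U(2) W(2)] has_vector_derivative_add[OF U(3) W(3)]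
      in \<open>auto simp: distrib_left\<close>)
qed

lemma wave_sol_diff:
  assumes "wave_sol b q U" "wave_sol b q W"
  shows "wave_sol b q (\<lambda>u v. U u v - W u v)"
  using wave_sol_add[OF assms(1) wave_sol_cmult[OF assms(2), of "-1"]] by simp

lemma wave_sol_sum:
  assumes "finite I" "\<And>i. i \<in> I \<Longrightarrow> wave_sol b q (U i)"
  shows "wave_sol b q (\<lambda>u v. \<Sum>i\<in>I. U i u v)"
  using assms
proof (induction I)
  case empty
  have "wave_sol b q (\<lambda>u v. 0)"
    by (rule wave_solI[of _ _ "\<lambda>u v. 0"]) (auto simp: case_prod_beta)
  then show ?case by simp
qed (simp add: wave_sol_add)

lemma compact_diamond: "compact (diamond b)"
proof -
  have "diamond b = {p. \<bar>fst p + snd p\<bar> \<le> b} \<inter> {p. \<bar>fst p - snd p\<bar> \<le> b}"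
    by (auto simp: diamond_def)
  then have "closed (diamond b)"
    by (auto intro!: closed_Int closed_Collect_le continuous_intros)
  moreover have "diamond b \<subseteq> {-b..b} \<times> {-b..b}"
    by (auto simp: diamond_iff)
  ultimately show ?thesis
    by (metis compact_Times compact_Icc compact_Int_closed inf.absorb_iff2)
qed

text \<open>At a maximum of \<open>|U u v| * exp (- \<mu> * (|u| + |v|))\<close> the double integral is smaller by
  a factor \<open>M / \<mu> < 1\<close>, with \<open>M\<close> a bound for \<open>q\<close>. Inner points suffice because every point of the
  diamond is the limit of its multiples by \<open>s < 1\<close>.\<close>

lemma wave_sol_unique_zero:
  assumes b: "b > 0" and q: "continuous_on {-b..b} q" and U: "wave_sol b q U"
    and zero: "\<And>x. x \<in> {-b..b} \<Longrightarrow> U x 0 = 0" "\<And>x. x \<in> {-b..b} \<Longrightarrow> U 0 x = 0"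
    and uv: "(u, v) \<in> diamond b"
  shows "U u v = 0"
proof -
  obtain U\<^sub>v where cont: "continuous_on (diamond b) (\<lambda>(u, v). U u v)"
    and dv: "\<And>u v. \<bar>u\<bar> + \<bar>v\<bar> < b \<Longrightarrow> ((\<lambda>y. U u y) has_vector_derivative U\<^sub>v u v) (at v)"
    and duv: "\<And>u v. \<bar>u\<bar> + \<bar>v\<bar> < b \<Longrightarrow> ((\<lambda>y. U\<^sub>v y v) has_vector_derivative q (u + v) * U u v) (at u)"
    using wave_solE[OF U] by metis
  obtain M where M: "M > 0" "\<And>x. x \<in> {-b..b} \<Longrightarrow> norm (q x) \<le> M"
    using compact_imp_bounded[OF compact_continuous_image[OF q compact_Icc]]
    unfolding bounded_pos by auto
  \<comment> \<open>\<open>\<mu> \<ge> 1\<close> permits discarding the gain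
    \<open>1 / \<mu>\<close> from the integration in \<open>u\<close>, while the one in
    \<open>v\<close> yields the factor \<open>M / \<mu> < 1\<close>.\<close>
  define \<mu> where "\<mu> = M + 1"
  have \<mu>: "\<mu> > 0" "M / \<mu> < 1" "\<mu> \<ge> 1" using M by (auto simp: \<mu>_def)
  define w where "w = (\<lambda>p. norm (U (fst p) (snd p)) * exp (- \<mu> * (\<bar>fst p\<bar> + \<bar>snd p\<bar>)))"
  have wc: "continuous_on (diamond b) w"
    using cont unfolding w_def case_prod_beta by (intro continuous_intros)
  have ne: "(0, 0) \<in> diamond b" using b by (simp add: diamond_iff)
  obtain p where p: "p \<in> diamond b" "\<And>z. z \<in> diamond b \<Longrightarrow> w z \<le> w p"
    using continuous_attains_sup[OF compact_diamond _ wc] ne by blast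
  have le: "norm (U u v) \<le> w p * exp (\<mu> * (\<bar>u\<bar> + \<bar>v\<bar>))" if "(u, v) \<in> diamond b" for u v
  proof -
    have "norm (U u v) = w (u, v) * exp (\<mu> * (\<bar>u\<bar> + \<bar>v\<bar>))"
      by (simp add: w_def mult.assoc exp_add[symmetric])
    also have "\<dots> \<le> w p * exp (\<mu> * (\<bar>u\<bar> + \<bar>v\<bar>))"
      by (intro mult_right_mono p that) simp
    finally show ?thesis .
  qed
  have wp: "w p \<ge> 0" by (simp add: w_def)
  have inner: "w (u, v) \<le> M / \<mu> * w p" if uv: "\<bar>u\<bar> + \<bar>v\<bar> < b" for u v
  proof -
    have U\<^sub>v0: "U\<^sub>v 0 t = 0" if "\<bar>t\<bar> < b" for t
    proof -
      \<comment> \<open>\<open>U\<^sub>v\<close> is known only through its existence; its initial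
        values for the integration in \<open>u\<close> come from differentiating the zero data along
        \<open>u = 0\<close>.\<close>
      have "((\<lambda>y. U 0 y) has_vector_derivative 0) (at t)"
      proof (rule has_vector_derivative_transform_within_open[of "\<lambda>_. 0" _ _ "{-b<..<b}"])
        show "0 = U 0 x" if "x \<in> {-b<..<b}" for x
          using zero(2)[of x] that by simp
      qed (use that in auto)
      moreover have "((\<lambda>y. U 0 y) has_vector_derivative U\<^sub>v 0 t) (at t)"
        using dv[of 0 t] that by simp
      ultimately show ?thesis by (metis vector_derivative_at)
    qed
    have dU\<^sub>v: "norm (U\<^sub>v u t) \<le> M * w p * exp (\<mu> * \<bar>u\<bar>) * exp (\<mu> * \<bar>t\<bar>)" if "\<bar>t\<bar> \<le> \<bar>v\<bar>" for t
    proof -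
      have "norm (U\<^sub>v u t - U\<^sub>v 0 t) \<le> (M * w p * exp (\<mu> * \<bar>t\<bar>)) / \<mu> * exp (\<mu> * \<bar>u\<bar>)"
      proof (rule exp_growth_bound[OF \<mu>(1)])
        fix s assume s: "\<bar>s\<bar> \<le> \<bar>u\<bar>"
        then have st: "\<bar>s\<bar> + \<bar>t\<bar> < b" using uv that by linarith
        show "((\<lambda>s. U\<^sub>v s t) has_vector_derivative q (s + t) * U s t) (at s)"
          using duv[OF st] .
        have "norm (q (s + t) * U s t) \<le> M * (w p * exp (\<mu> * (\<bar>s\<bar> + \<bar>t\<bar>)))"
          unfolding norm_mult
          by (intro mult_mono M le) (use st M in \<open>auto simp: diamond_iff\<close>)
        then show "norm (q (s + t) * U s t) \<le> M * w p * exp (\<mu> * \<bar>t\<bar>) * exp (\<mu> * \<bar>s\<bar>)"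
          by (simp add: distrib_left exp_add mult_ac)
      qed
      also have "\<dots> \<le> M * w p * exp (\<mu> * \<bar>t\<bar>) * exp (\<mu> * \<bar>u\<bar>)"
      proof (intro mult_right_mono)
        have "0 \<le> M * w p * exp (\<mu> * \<bar>t\<bar>)" using M wp by simp
        with \<mu> show "M * w p * exp (\<mu> * \<bar>t\<bar>) / \<mu> \<le> M * w p * exp (\<mu> * \<bar>t\<bar>)"
          by (simp add: divide_le_eq mult_le_cancel_left1)
      qed simp
      finally show ?thesis
        using U\<^sub>v0[of t] that uv by (simp add: mult_ac)
    qed
    have "norm (U u v - U u 0) \<le> (M * w p * exp (\<mu> * \<bar>u\<bar>)) / \<mu> * exp (\<mu> * \<bar>v\<bar>)"
    proof (rule exp_growth_bound[OF \<mu>(1)])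
      fix s assume s: "\<bar>s\<bar> \<le> \<bar>v\<bar>"
      then show "((\<lambda>s. U u s) has_vector_derivative U\<^sub>v u s) (at s)"
        using dv uv by simp
    qed (use dU\<^sub>v in auto)
    moreover have "-b \<le> u" "u \<le> b" using uv by linarith+
    then have "U u 0 = 0"
      using zero(1)[of u] by simp
    ultimately have "norm (U u v) \<le> M / \<mu> * w p * exp (\<mu> * (\<bar>u\<bar> + \<bar>v\<bar>))"
      by (simp add: distrib_left exp_add mult_ac)
    then have "norm (U u v) * exp (- \<mu> * (\<bar>u\<bar> + \<bar>v\<bar>)) \<le>
       M / \<mu> * w p * exp (\<mu> * (\<bar>u\<bar> + \<bar>v\<bar>)) * exp (- \<mu> * (\<bar>u\<bar> + \<bar>v\<bar>))"
      by (intro mult_right_mono) auto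
    then show ?thesis
      by (simp add: w_def mult.assoc exp_add[symmetric])
  qed
  obtain x y where xy: "p = (x, y)" by (cases p)
  have "w p \<le> M / \<mu> * w p"
  proof (rule tendsto_upperbound)
    have "continuous_on {0..1} (\<lambda>s. w (s * x, s * y))"
    proof (rule continuous_on_compose2[OF wc])
      show "(\<lambda>s. (s * x, s * y)) ` {0..1} \<subseteq> diamond b"
      proof safe
        fix s :: real assume s: "s \<in> {0..1}"
        then have "s * (\<bar>x\<bar> + \<bar>y\<bar>) \<le> 1 * b"
          using p(1) b by (intro mult_mono) (auto simp: xy diamond_iff)
        then show "(s * x, s * y) \<in> diamond b"
          using s by (simp add: diamond_iff abs_mult distrib_left)
      qed
    qed (intro continuous_intros)
    then have "((\<lambda>s. w (s * x, s * y)) \<longlongrightarrow> w (1 * x, 1 * y)) (at 1 within {0..1})"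
      unfolding continuous_on_def by (rule bspec) simp
    then show "((\<lambda>s. w (s * x, s * y)) \<longlongrightarrow> w p) (at_left 1)"
      by (simp add: xy at_within_Icc_at_left)
    have "eventually (\<lambda>s. s \<in> {0<..<1}) (at_left (1::real))"
      by (intro eventually_at_leftI[of 0]) auto
    then show "eventually (\<lambda>s. w (s * x, s * y) \<le> M / \<mu> * w p) (at_left 1)"
    proof eventually_elim
      case (elim s)
      have "s * (\<bar>x\<bar> + \<bar>y\<bar>) \<le> s * b"
        using p(1) elim by (intro mult_left_mono) (auto simp: xy diamond_iff)
      also have "\<dots> < 1 * b" using elim b by (intro mult_strict_right_mono) auto
      finally show ?case using elim by (intro inner) (simp add: abs_mult distrib_left)
    qed
  qed simp
  then have "w p * (1 - M / \<mu>) \<le> 0" by (simp add: algebra_simps)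
  then have "w p = 0"
    using \<mu>(2) wp by (simp add: mult_le_0_iff)
  then show ?thesis using le[OF uv] by simp
qed

section \<open>Extension of the Goursat kernel to the whole plane\<close>

lemma compact_extension:
  fixes f :: "'a::{metric_space,second_countable_topology} \<Rightarrow> complex"
  assumes "compact S" "continuous_on S f"
  obtains g where "continuous_on UNIV g" "\<And>x. x \<in> S \<Longrightarrow> g x = f x"
proof -
  obtain B where B: "B > 0" "\<And>x. x \<in> S \<Longrightarrow> norm (f x) \<le> B"
    using compact_imp_bounded[OF compact_continuous_image[OF assms(2,1)]]
    unfolding bounded_pos by auto
  have "closedin (top_of_set UNIV) S"
    using compact_imp_closed[OF assms(1)] by simp
  from Tietze[OF assms(2) this less_imp_le[OF B(1)] B(2)] that show thesis
    by metis
qed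

text \<open>A Goursat solution extended to the whole plane together with its derivatives, so that
  no integral or derivative needs a domain condition; only the equation itself remains confined
  to the diamond.\<close>

locale goursat_kernel =
  fixes b :: real and q :: "real \<Rightarrow> complex" and h :: complex
    and H H\<^sub>u H\<^sub>v G :: "real \<Rightarrow> real \<Rightarrow> complex"
  assumes b_pos: "b > 0"
    and q_cont: "continuous_on UNIV q"
    and H_cont: "continuous_on UNIV (\<lambda>(u, v). H u v)"
    and H\<^sub>u_cont: "continuous_on UNIV (\<lambda>(u, v). H\<^sub>u u v)"
    and H\<^sub>v_cont: "continuous_on UNIV (\<lambda>(u, v). H\<^sub>v u v)"
    and G_cont: "continuous_on UNIV (\<lambda>(u, v). G u v)"
    and deriv_H_u: "((\<lambda>u. H u v) has_vector_derivative H\<^sub>u u v) (at u)"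
    and deriv_H_v: "((\<lambda>v. H u v) has_vector_derivative H\<^sub>v u v) (at v)"
    and deriv_H\<^sub>u_v: "((\<lambda>v. H\<^sub>u u v) has_vector_derivative G u v) (at v)"
    and deriv_H\<^sub>v_u: "((\<lambda>u. H\<^sub>v u v) has_vector_derivative G u v) (at u)"
    and H_u0: "H u 0 = h / 2 + 1 / 2 * oint 0 u q"
    and H_0v: "H 0 v = h / 2"
    and H\<^sub>u_u0: "H\<^sub>u u 0 = q u / 2"
    and H\<^sub>v_0v: "H\<^sub>v 0 v = 0"
    and G_eq: "(u, v) \<in> diamond b \<Longrightarrow> G u v = q (u + v) * H u v"

text \<open>Extend the mixed derivative \<open>q (u + v) * H u v\<close> continuously to the plane and integrate
  it back; the result agrees with \<open>H\<close> by uniqueness for the equation with zero potential.\<close>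

lemma goursat_extension:
  assumes b: "b > 0" and q: "continuous_on {-b..b} q" and H: "goursat_solution b q h H"
  obtains q' H' H\<^sub>u H\<^sub>v G where "goursat_kernel b q' h H' H\<^sub>u H\<^sub>v G"
    "\<And>x. x \<in> {-b..b} \<Longrightarrow> q' x = q x" "\<And>u v. (u, v) \<in> diamond b \<Longrightarrow> H' u v = H u v"
proof -
  have "wave_sol b q H"
    using H by (simp add: goursat_solution_def wave_sol_def diamond_def)
  then obtain D where cont: "continuous_on (diamond b) (\<lambda>(u, v). H u v)"
    and dv: "\<And>u v. \<bar>u\<bar> + \<bar>v\<bar> < b \<Longrightarrow> ((\<lambda>y. H u y) has_vector_derivative D u v) (at v)"
    and duv: "\<And>u v. \<bar>u\<bar> + \<bar>v\<bar> < b \<Longrightarrow> ((\<lambda>y. D y v) has_vector_derivative q (u + v) * H u v) (at u)"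
    using wave_solE by metis
  obtain q' where q': "continuous_on UNIV q'" "\<And>x. x \<in> {-b..b} \<Longrightarrow> q' x = q x"
    using compact_extension[OF compact_Icc q] by metis
  have "continuous_on (diamond b) (\<lambda>(u, v). q' (u + v) * H u v)"
    using cont unfolding case_prod_beta
    by (intro continuous_on_mult continuous_on_compose2[OF q'(1)] continuous_intros) auto
  from compact_extension[OF compact_diamond this]
  obtain G' where G': "continuous_on UNIV G'"
    "\<And>p. p \<in> diamond b \<Longrightarrow> G' p = (\<lambda>(u, v). q' (u + v) * H u v) p" by metis
  define G where "G = (\<lambda>u v. G' (u, v))"
  have Gc: "continuous_on UNIV (\<lambda>(u, v). G u v)"
    using G'(1) by (simp add: G_def)
  have G: "G u v = q (u + v) * H u v" "G u v = q' (u + v) * H u v" if "(u, v) \<in> diamond b" for u v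
    using G'(2)[OF that] q'(2)[of "u + v"] that by (auto simp: G_def diamond_def abs_le_iff)
  define H\<^sub>u where "H\<^sub>u = (\<lambda>u v. 1 / 2 * q' u + oint 0 v (G u))"
  define H\<^sub>v where "H\<^sub>v = (\<lambda>u v. oint 0 u (\<lambda>r. G r v))"
  define H' where "H' = (\<lambda>u v. h / 2 + 1 / 2 * oint 0 u q' + oint 0 u (\<lambda>r. oint 0 v (G r)))"
  have I: "continuous_on UNIV (\<lambda>(u, v). oint 0 v (G u))"
    unfolding case_prod_beta
    by (intro oint_cont_UNIV cont_comp2[OF Gc] continuous_intros)
  have H\<^sub>vc: "continuous_on UNIV (\<lambda>(u, v). H\<^sub>v u v)"
    unfolding case_prod_beta H\<^sub>v_def
    by (intro oint_cont_UNIV cont_comp2[OF Gc] continuous_intros)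
  have H\<^sub>uc: "continuous_on UNIV (\<lambda>(u, v). H\<^sub>u u v)"
    using I unfolding case_prod_beta H\<^sub>u_def
    by (intro continuous_intros continuous_on_compose2[OF q'(1)]) auto
  have H'c: "continuous_on UNIV (\<lambda>(u, v). H' u v)"
    unfolding case_prod_beta H'_def
    by (intro oint_cont_UNIV cont_comp2[OF I] continuous_intros continuous_on_compose2[OF q'(1)] subset_UNIV)
  have dH'u: "((\<lambda>u. H' u v) has_vector_derivative H\<^sub>u u v) (at u)" for u v
    unfolding H'_def H\<^sub>u_def
    by (auto intro!: derivative_eq_intros oint_deriv q'(1) cont_comp2[OF I] continuous_intros)
  have dH'v: "((\<lambda>v. H' u v) has_vector_derivative H\<^sub>v u v) (at v)" for u v
  proof -
    have "((\<lambda>v. oint 0 u (\<lambda>r. oint 0 v (G r))) has_vector_derivative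
       0 *\<^sub>R oint 0 v (G u) - 0 *\<^sub>R oint 0 v (G 0) + oint 0 u (\<lambda>r. G r v)) (at v)"
    proof (rule oint_leibniz)
      show "continuous_on UNIV (\<lambda>(v, r). oint 0 v (G r))"
        unfolding case_prod_beta by (intro cont_comp2[OF I] continuous_intros)
      show "continuous_on UNIV (\<lambda>(v, r). G r v)"
        unfolding case_prod_beta by (intro cont_comp2[OF Gc] continuous_intros)
      show "((\<lambda>y. oint 0 y (G r)) has_vector_derivative G r y) (at y)" for y r
        by (intro oint_deriv cont_comp2[OF Gc] continuous_intros)
    qed auto
    then show ?thesis
      unfolding H'_def H\<^sub>v_def by (auto intro!: derivative_eq_intros)
  qed
  have dH\<^sub>uv: "((\<lambda>v. H\<^sub>u u v) has_vector_derivative G u v) (at v)" for u v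
    unfolding H\<^sub>u_def by (auto intro!: derivative_eq_intros oint_deriv cont_comp2[OF Gc] continuous_intros)
  have dH\<^sub>vu: "((\<lambda>u. H\<^sub>v u v) has_vector_derivative G u v) (at u)" for u v
    unfolding H\<^sub>v_def by (auto intro!: oint_deriv cont_comp2[OF Gc] continuous_intros)
  have bd: "H' u 0 = h / 2 + 1 / 2 * oint 0 u q'" "H' 0 v = h / 2" for u v
    using oint_cmult[of 0 u 0 "\<lambda>_. 0"] by (auto simp: H'_def)
  have eq: "H' u v = H u v" if uv: "(u, v) \<in> diamond b" for u v
  proof -
    have "H u v - H' u v = 0"
    proof (rule wave_sol_unique_zero[OF b continuous_on_const[of _ 0] _ _ _ uv])
      show "wave_sol b (\<lambda>_. 0) (\<lambda>u v. H u v - H' u v)"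
      proof (rule wave_solI[of _ _ "\<lambda>u v. D u v - H\<^sub>v u v"])
        show "continuous_on (diamond b) (\<lambda>(u, v). H u v - H' u v)"
          using continuous_on_diff[OF cont continuous_on_subset[OF H'c subset_UNIV]]
          by (simp add: case_prod_beta)
      next
        fix u v :: real assume uv: "\<bar>u\<bar> + \<bar>v\<bar> < b"
        show "((\<lambda>y. H u y - H' u y) has_vector_derivative D u v - H\<^sub>v u v) (at v)"
          by (intro derivative_intros dv[OF uv] dH'v)
        show "((\<lambda>y. D y v - H\<^sub>v y v) has_vector_derivative 0 * (H u v - H' u v)) (at u)"
          using has_vector_derivative_diff[OF duv[OF uv] dH\<^sub>vu[of v u]] G[of u v] uv
          by (simp add: diamond_iff)
      qed
    next
      fix x assume x: "x \<in> {-b..b}"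
      have "oint 0 x q' = oint 0 x q"
      proof (rule oint_cong)
        fix r assume "min 0 x \<le> r" "r \<le> max 0 x"
        with x have "r \<in> {-b..b}" by (auto simp: min_def max_def split: if_splits)
        then show "q' r = q r" by (rule q'(2))
      qed
      then show "H x 0 - H' x 0 = 0" "H 0 x - H' 0 x = 0"
        using H x unfolding bd goursat_solution_def by (auto simp: oint_def zero_ereal_def)
    qed
    then show ?thesis by simp
  qed
  have "goursat_kernel b q' h H' H\<^sub>u H\<^sub>v G"
  proof
    show "G u v = q' (u + v) * H' u v" if uv: "(u, v) \<in> diamond b" for u v
      using G(2)[OF uv] eq[OF uv] by simp
    show "H\<^sub>u u 0 = q' u / 2" for u by (simp add: H\<^sub>u_def)
    show "H\<^sub>v 0 v = 0" for v by (simp add: H\<^sub>v_def)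
  qed (fact b q'(1) H'c H\<^sub>uc H\<^sub>vc Gc dH'u dH'v dH\<^sub>uv dH\<^sub>vu bd)+
  then show thesis
    using that q'(2) eq by blast
qed

section \<open>Volterra equations on a symmetric interval\<close>

text \<open>The second integral reaches to the reflected point \<open>-x\<close>, so the operator is
  of Volterra type with respect to \<open>\<bar>x\<bar>\<close> rather than \<open>x\<close>. This
  is why all weights are functions of \<open>\<bar>x\<bar>\<close>.\<close>

definition volterra :: "(real \<Rightarrow> real \<Rightarrow> complex) \<Rightarrow> (real \<Rightarrow> real \<Rightarrow> complex) \<Rightarrow> (real \<Rightarrow> complex) \<Rightarrow> real \<Rightarrow> complex" where
  "volterra A B g x = oint 0 x (\<lambda>t. A x t * g t) + oint (-x) 0 (\<lambda>t. B x t * g t)"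

lemma volterra_cont:
  assumes "continuous_on UNIV (\<lambda>(x, t). A x t)" "continuous_on UNIV (\<lambda>(x, t). B x t)"
    and "continuous_on UNIV g"
  shows "continuous_on S (volterra A B g)"
  unfolding volterra_def[abs_def]
  by (intro continuous_intros oint_cont_UNIV cont_comp2[OF assms(1)] cont_comp2[OF assms(2)]
      continuous_on_compose2[OF assms(3)] subset_UNIV)

lemma volterra_diff:
  assumes "continuous_on UNIV (\<lambda>(x, t). A x t)" "continuous_on UNIV (\<lambda>(x, t). B x t)"
    and "continuous_on UNIV g" "continuous_on UNIV g'"
  shows "volterra A B (\<lambda>t. g t - g' t) x = volterra A B g x - volterra A B g' x"
proof -
  have "continuous_on UNIV (\<lambda>t. A x t * k t)" "continuous_on UNIV (\<lambda>t. B x t * k t)"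
    if "continuous_on UNIV k" for k
    by (intro continuous_intros cont_comp2[OF assms(1)] cont_comp2[OF assms(2)] that)+
  then show ?thesis
    using assms(3,4) by (simp add: volterra_def right_diff_distrib oint_diff)
qed

lemma volterra_deriv:
  assumes A: "continuous_on UNIV (\<lambda>(x, t). A x t)" and B: "continuous_on UNIV (\<lambda>(x, t). B x t)"
    and A': "continuous_on UNIV (\<lambda>(x, t). A' x t)" and B': "continuous_on UNIV (\<lambda>(x, t). B' x t)"
    and dA: "\<And>x t. ((\<lambda>x. A x t) has_vector_derivative A' x t) (at x)"
    and dB: "\<And>x t. ((\<lambda>x. B x t) has_vector_derivative B' x t) (at x)"
    and g: "continuous_on UNIV g"
  shows "(volterra A B g has_vector_derivative
    A x x * g x + B x (-x) * g (-x) + volterra A' B' g x) (at x)"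
proof -
  have "((\<lambda>x. oint 0 x (\<lambda>t. A x t * g t)) has_vector_derivative
     1 *\<^sub>R (A x x * g x) - 0 *\<^sub>R (A x 0 * g 0) + oint 0 x (\<lambda>t. A' x t * g t)) (at x)"
    by (rule oint_leibniz[where F = "\<lambda>x t. A x t * g t"], unfold case_prod_beta)
      (intro continuous_intros cont_comp2[OF A] cont_comp2[OF A'] continuous_on_compose2[OF g] subset_UNIV
        has_vector_derivative_mult_left dA derivative_eq_intros; simp)+
  moreover have "((\<lambda>x. oint (-x) 0 (\<lambda>t. B x t * g t)) has_vector_derivative
     0 *\<^sub>R (B x 0 * g 0) - (-1) *\<^sub>R (B x (-x) * g (-x)) + oint (-x) 0 (\<lambda>t. B' x t * g t)) (at x)"
    by (rule oint_leibniz[where F = "\<lambda>x t. B x t * g t"], unfold case_prod_beta)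
      (intro continuous_intros cont_comp2[OF B] cont_comp2[OF B'] continuous_on_compose2[OF g] subset_UNIV
        has_vector_derivative_mult_left dB derivative_eq_intros; simp)+
  ultimately show ?thesis
    unfolding volterra_def[abs_def]
    by (auto intro!: derivative_eq_intros simp: algebra_simps)
qed

text \<open>Up to orientation both integrals start at 0, so each gains \<open>1 / \<mu>\<close>
  against the weight; the factor 2 counts them.\<close>

lemma volterra_norm_le:
  assumes A: "continuous_on UNIV (\<lambda>(x, t). A x t)" and B: "continuous_on UNIV (\<lambda>(x, t). B x t)"
    and g: "continuous_on UNIV g" and M: "M \<ge> 0" and \<mu>: "\<mu> > 0"
    and bound: "\<And>x t. x \<in> {-b..b} \<Longrightarrow> t \<in> {-b..b} \<Longrightarrow> norm (A x t) \<le> M \<and> norm (B x t) \<le> M"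
    and gc: "\<And>t. t \<in> {-b..b} \<Longrightarrow> norm (g t) \<le> c * exp (\<mu> * \<bar>t\<bar>)" and x: "x \<in> {-b..b}"
  shows "norm (volterra A B g x) \<le> 2 * M / \<mu> * c * exp (\<mu> * \<bar>x\<bar>)"
proof -
  have le: "norm (k t * g t) \<le> M * c * exp (\<mu> * \<bar>t\<bar>)"
    if "t \<in> {-b..b}" "norm (k t) \<le> M" for k :: "real \<Rightarrow> complex" and t
    using mult_mono[OF that(2) gc[OF that(1)]] M by (simp add: norm_mult mult.assoc)
  have A1: "continuous_on UNIV (\<lambda>t. A x t * g t)" and B1: "continuous_on UNIV (\<lambda>t. B x t * g t)"
    by (intro continuous_intros cont_comp2[OF A] cont_comp2[OF B] g)+
  have "norm (oint 0 x (\<lambda>t. A x t * g t) - oint 0 0 (\<lambda>t. A x t * g t)) \<le> (M * c) / \<mu> * exp (\<mu> * \<bar>x\<bar>)"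
  proof (rule exp_growth_bound[OF \<mu> oint_deriv[OF A1]])
    fix t assume "\<bar>t\<bar> \<le> \<bar>x\<bar>"
    with x have "t \<in> {-b..b}" by auto
    then show "norm (A x t * g t) \<le> M * c * exp (\<mu> * \<bar>t\<bar>)"
      using x bound by (intro le) auto
  qed
  moreover have "norm (oint 0 (-x) (\<lambda>t. B x t * g t) - oint 0 0 (\<lambda>t. B x t * g t)) \<le> (M * c) / \<mu> * exp (\<mu> * \<bar>-x\<bar>)"
  proof (rule exp_growth_bound[OF \<mu> oint_deriv[OF B1]])
    fix t assume "\<bar>t\<bar> \<le> \<bar>-x\<bar>"
    with x have "t \<in> {-b..b}" by auto
    then show "norm (B x t * g t) \<le> M * c * exp (\<mu> * \<bar>t\<bar>)"
      using x bound by (intro le) auto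
  qed
  moreover have "volterra A B g x = oint 0 x (\<lambda>t. A x t * g t) - oint 0 (-x) (\<lambda>t. B x t * g t)"
    using oint_split[OF B1, of "-x" 0 0] by (simp add: volterra_def)
  ultimately have "norm (volterra A B g x) \<le> (M * c) / \<mu> * exp (\<mu> * \<bar>x\<bar>) + (M * c) / \<mu> * exp (\<mu> * \<bar>-x\<bar>)"
    using norm_triangle_ineq4[of "oint 0 x (\<lambda>t. A x t * g t)" "oint 0 (-x) (\<lambda>t. B x t * g t)"]
    by simp
  then show ?thesis by simp
qed

lemma kernels_bounded:
  fixes b :: real
  assumes A: "continuous_on UNIV (\<lambda>(x, t). A x t)" and B: "continuous_on UNIV (\<lambda>(x, t). B x t)"
  obtains M :: real where "M > 0"
    "\<And>x t. x \<in> {-b..b} \<Longrightarrow> t \<in> {-b..b} \<Longrightarrow> norm (A x t :: complex) \<le> M \<and> norm (B x t :: complex) \<le> M"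
proof -
  have "compact ({-b..b} \<times> {-b..b})" by (intro compact_Times) auto
  then have "bounded ((\<lambda>(x, t). A x t) ` ({-b..b} \<times> {-b..b}))" "bounded ((\<lambda>(x, t). B x t) ` ({-b..b} \<times> {-b..b}))"
    by (auto intro!: compact_imp_bounded compact_continuous_image continuous_on_subset[OF A] continuous_on_subset[OF B])
  then obtain M1 M2 where "M1 > 0" "M2 > 0"
    "\<And>x t. x \<in> {-b..b} \<Longrightarrow> t \<in> {-b..b} \<Longrightarrow> norm (A x t) \<le> M1"
    "\<And>x t. x \<in> {-b..b} \<Longrightarrow> t \<in> {-b..b} \<Longrightarrow> norm (B x t) \<le> M2"
    unfolding bounded_pos by fastforce
  then show thesis
    by (intro that[of "max M1 M2"]) (auto simp: le_max_iff_disj)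
qed

text \<open>The weight \<open>exp (\<mu> * |x|)\<close> with \<open>\<mu> = 4 * M\<close> makes the operator a contraction with factor
  \<open>1 / 2\<close>, both here and in the fixed point argument for solvability.\<close>

lemma volterra_stable:
  assumes A: "continuous_on UNIV (\<lambda>(x, t). A x t)" and B: "continuous_on UNIV (\<lambda>(x, t). B x t)" and b: "b > 0"
  obtains C :: real where "C \<ge> 0" "\<And>g m x. \<lbrakk>continuous_on UNIV g; x \<in> {-b..b};
    \<And>x. x \<in> {-b..b} \<Longrightarrow> norm (g x + volterra A B g x) \<le> m\<rbrakk> \<Longrightarrow> norm (g x) \<le> C * m"
proof -
  obtain M where M: "M > 0"
    "\<And>x t. x \<in> {-b..b} \<Longrightarrow> t \<in> {-b..b} \<Longrightarrow> norm (A x t) \<le> M \<and> norm (B x t) \<le> M"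
    using kernels_bounded[OF A B] by metis
  define \<mu> where "\<mu> = 4 * M"
  have \<mu>: "\<mu> > 0" using M by (simp add: \<mu>_def)
  show thesis
  proof (rule that[of "2 * exp (\<mu> * b)"])
    fix g m x
    assume g: "continuous_on UNIV g" and x: "x \<in> {-b..b}"
      and m: "\<And>x. x \<in> {-b..b} \<Longrightarrow> norm (g x + volterra A B g x) \<le> m"
    have m0: "m \<ge> 0" using m[OF x] norm_ge_zero order_trans by blast
    have "continuous_on {-b..b} (\<lambda>t. norm (g t) * exp (- \<mu> * \<bar>t\<bar>))"
      by (intro continuous_intros continuous_on_subset[OF g]) auto
    moreover have "{-b..b} \<noteq> {}" using x by auto
    ultimately obtain p where p: "p \<in> {-b..b}"
      "\<And>t. t \<in> {-b..b} \<Longrightarrow> norm (g t) * exp (- \<mu> * \<bar>t\<bar>) \<le> norm (g p) * exp (- \<mu> * \<bar>p\<bar>)"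
      using continuous_attains_sup[OF compact_Icc] by blast
    define c where "c = norm (g p) * exp (- \<mu> * \<bar>p\<bar>)"
    have gc: "norm (g t) \<le> c * exp (\<mu> * \<bar>t\<bar>)" if "t \<in> {-b..b}" for t
    proof -
      have "norm (g t) = norm (g t) * exp (- \<mu> * \<bar>t\<bar>) * exp (\<mu> * \<bar>t\<bar>)"
        by (simp add: mult.assoc exp_add[symmetric])
      also have "\<dots> \<le> c * exp (\<mu> * \<bar>t\<bar>)"
        unfolding c_def by (intro mult_right_mono p that) simp
      finally show ?thesis .
    qed
    have "norm (g p) \<le> norm (g p + volterra A B g p) + norm (volterra A B g p)"
      using norm_triangle_ineq4[of "g p + volterra A B g p" "volterra A B g p"] by simp
    also have "\<dots> \<le> m + 2 * M / \<mu> * c * exp (\<mu> * \<bar>p\<bar>)"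
    proof (rule add_mono)
      show "norm (g p + volterra A B g p) \<le> m" by (rule m[OF p(1)])
      show "norm (volterra A B g p) \<le> 2 * M / \<mu> * c * exp (\<mu> * \<bar>p\<bar>)"
        using M by (intro volterra_norm_le[OF A B g _ \<mu> _ gc p(1)]) auto
    qed
    \<comment> \<open>Here \<open>2 * M / \<mu> = 1 / 2\<close>, and \<open>m\<close> may be
      multiplied by an exponential that is at least 1. Multiplied by the weight at \<open>p\<close>,
      the chain reads \<open>c \<le> m + c / 2\<close>.\<close>
    also have "\<dots> \<le> m * exp (\<mu> * \<bar>p\<bar>) + c / 2 * exp (\<mu> * \<bar>p\<bar>)"
      using M(1) m0 \<mu> by (intro add_mono) (auto simp: \<mu>_def mult_le_cancel_left1)
    finally have "norm (g p) * exp (- \<mu> * \<bar>p\<bar>) \<le> (m * exp (\<mu> * \<bar>p\<bar>) + c / 2 * exp (\<mu> * \<bar>p\<bar>)) * exp (- \<mu> * \<bar>p\<bar>)"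
      by (intro mult_right_mono) auto
    also have "\<dots> = m + c / 2"
      by (simp add: distrib_right mult.assoc exp_add[symmetric])
    finally have c: "c \<le> 2 * m" by (simp add: c_def)
    have "norm (g x) \<le> c * exp (\<mu> * \<bar>x\<bar>)" by (rule gc[OF x])
    also have "\<dots> \<le> (2 * m) * exp (\<mu> * b)"
      using c m0 x \<mu> by (intro mult_mono) auto
    finally show "norm (g x) \<le> 2 * exp (\<mu> * b) * m" by (simp add: mult_ac)
  qed simp
qed

text \<open>The Banach fixed point theorem is applied to \<open>k = g / E\<close>, so that the
  ordinary supremum norm of \<open>k\<close> plays the part of the weighted norm of
  \<open>g\<close>. The clamp \<open>cl\<close> onto the interval turns \<open>R k\<close> into a
  bounded continuous function on the whole line, hence into an element of a complete type.\<close>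

lemma volterra_solvable:
  assumes A: "continuous_on UNIV (\<lambda>(x, t). A x t)" and B: "continuous_on UNIV (\<lambda>(x, t). B x t)" and b: "b > 0"
    and F: "continuous_on UNIV F"
  obtains g where "continuous_on UNIV g" "\<And>x. x \<in> {-b..b} \<Longrightarrow> g x + volterra A B g x = F x"
proof -
  obtain M where M: "M > 0"
    "\<And>x t. x \<in> {-b..b} \<Longrightarrow> t \<in> {-b..b} \<Longrightarrow> norm (A x t) \<le> M \<and> norm (B x t) \<le> M"
    using kernels_bounded[OF A B] by metis
  define \<mu> where "\<mu> = 4 * M"
  have \<mu>: "\<mu> > 0" using M by (simp add: \<mu>_def)
  define E :: "real \<Rightarrow> complex" where "E = (\<lambda>t. of_real (exp (\<mu> * \<bar>t\<bar>)))"
  define cl where "cl = (\<lambda>x. max (-b) (min b x))"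
  have cl: "cl x \<in> {-b..b}" for x using b by (auto simp: cl_def)
  have Ek: "continuous_on UNIV (\<lambda>t. E t * apply_bcontfun k t)" for k
    unfolding E_def by (intro continuous_intros continuous_on_apply_bcontfun)
  define R where "R = (\<lambda>k x. (F x - volterra A B (\<lambda>t. E t * apply_bcontfun k t) x) / E x)"
  define \<Theta> where "\<Theta> = (\<lambda>k. Bcontfun (\<lambda>x. R k (cl x)))"
  have Rc: "continuous_on S (R k)" for k S
    unfolding R_def by (intro continuous_intros continuous_on_subset[OF F] volterra_cont A B Ek)
      (auto simp: E_def intro!: continuous_intros)
  have app: "apply_bcontfun (\<Theta> k) x = R k (cl x)" for k x
  proof -
    have "(\<lambda>x. R k (cl x)) \<in> bcontfun"
    proof -
      have "bounded (R k ` {-b..b})"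
        by (intro compact_imp_bounded compact_continuous_image Rc compact_Icc)
      then obtain m where "\<And>x. x \<in> {-b..b} \<Longrightarrow> norm (R k x) \<le> m"
        unfolding bounded_iff by blast
      moreover have "continuous_on UNIV (\<lambda>x. R k (cl x))"
        by (rule continuous_on_compose2[OF Rc[of UNIV]]) (auto simp: cl_def intro!: continuous_intros)
      ultimately show ?thesis
        using cl by (intro bcontfun_normI[of _ m]) auto
    qed
    then show ?thesis by (simp add: \<Theta>_def Bcontfun_inverse)
  qed
  have "\<exists>!k. \<Theta> k = k"
  proof (rule banach_fix_type[of "1/2"], simp, simp, intro allI dist_bound)
    fix k k' :: "real \<Rightarrow>\<^sub>C complex" and x
    let ?d = "\<lambda>t. E t * apply_bcontfun k t - E t * apply_bcontfun k' t"
    have eq: "R k (cl x) - R k' (cl x) = - volterra A B ?d (cl x) / E (cl x)"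
      by (simp add: R_def volterra_diff[OF A B Ek Ek] diff_divide_distrib)
    have "norm (volterra A B ?d (cl x)) \<le> 2 * M / \<mu> * dist k k' * exp (\<mu> * \<bar>cl x\<bar>)"
    proof (rule volterra_norm_le[OF A B _ less_imp_le[OF M(1)] \<mu> M(2)])
      show "continuous_on UNIV ?d" by (intro continuous_on_diff Ek)
      fix t
      have "?d t = E t * (apply_bcontfun k t - apply_bcontfun k' t)" by (simp add: right_diff_distrib)
      then have "norm (?d t) = exp (\<mu> * \<bar>t\<bar>) * dist (apply_bcontfun k t) (apply_bcontfun k' t)"
        by (simp add: norm_mult E_def dist_norm)
      then show "norm (?d t) \<le> dist k k' * exp (\<mu> * \<bar>t\<bar>)"
        by (simp add: mult.commute dist_bounded)
    qed (use cl in auto)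
    then show "dist (apply_bcontfun (\<Theta> k) x) (apply_bcontfun (\<Theta> k') x) \<le> 1 / 2 * dist k k'"
      using M(1) by (simp add: app dist_norm eq norm_divide E_def divide_le_eq \<mu>_def)
  qed
  then obtain k where k: "\<Theta> k = k" by auto
  show thesis
  proof (rule that[of "\<lambda>t. E t * apply_bcontfun k t", OF Ek])
    fix x assume "x \<in> {-b..b}"
    then have "apply_bcontfun k x = R k x"
      using app[of k x] by (simp add: k cl_def)
    then show "E x * apply_bcontfun k x + volterra A B (\<lambda>t. E t * apply_bcontfun k t) x = F x"
      by (simp add: R_def E_def)
  qed
qed

section \<open>Generalized wave polynomials\<close>

definition C1_on :: "real set \<Rightarrow> (real \<Rightarrow> complex) \<Rightarrow> bool" where
  "C1_on S g \<longleftrightarrow> (\<exists>g'. continuous_on S g' \<and> (\<forall>x\<in>S. (g has_vector_derivative g' x) (at x within S)))"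

lemma C1_on_imp_continuous: "C1_on S g \<Longrightarrow> continuous_on S g"
  unfolding C1_on_def continuous_on_eq_continuous_within by (blast intro: has_vector_derivative_continuous)

lemma C1_on_const: "C1_on S (\<lambda>_. c)"
  unfolding C1_on_def by (intro exI[of _ "\<lambda>_. 0"]) auto

lemma C1_on_add:
  assumes "C1_on S f" "C1_on S g"
  shows "C1_on S (\<lambda>x. f x + g x)"
proof -
  obtain f' g' where "continuous_on S f'" "\<And>x. x \<in> S \<Longrightarrow> (f has_vector_derivative f' x) (at x within S)"
    "continuous_on S g'" "\<And>x. x \<in> S \<Longrightarrow> (g has_vector_derivative g' x) (at x within S)"
    using assms unfolding C1_on_def by auto
  then show ?thesis
    unfolding C1_on_def by (intro exI[of _ "\<lambda>x. f' x + g' x"]) (auto intro!: continuous_intros derivative_intros)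
qed

lemma C1_on_mult:
  assumes "C1_on S f" "C1_on S g"
  shows "C1_on S (\<lambda>x. f x * g x)"
proof -
  obtain f' g' where *: "continuous_on S f'" "\<And>x. x \<in> S \<Longrightarrow> (f has_vector_derivative f' x) (at x within S)"
    "continuous_on S g'" "\<And>x. x \<in> S \<Longrightarrow> (g has_vector_derivative g' x) (at x within S)"
    using assms unfolding C1_on_def by auto
  have "continuous_on S (\<lambda>x. f x * g' x + f' x * g x)"
    by (intro continuous_intros * assms[THEN C1_on_imp_continuous])
  with * show ?thesis
    unfolding C1_on_def by (intro exI[of _ "\<lambda>x. f x * g' x + f' x * g x"]) (auto intro!: derivative_intros)
qed

lemma C1_on_cmult: "C1_on S f \<Longrightarrow> C1_on S (\<lambda>x. c * f x)"
  by (intro C1_on_mult C1_on_const)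

lemma C1_on_diff: "C1_on S f \<Longrightarrow> C1_on S g \<Longrightarrow> C1_on S (\<lambda>x. f x - g x)"
  using C1_on_add[of S f "\<lambda>x. -1 * g x"] C1_on_cmult[of S g "-1"] by simp

lemma C1_on_cong:
  assumes "C1_on S f" "\<And>x. x \<in> S \<Longrightarrow> f x = g x"
  shows "C1_on S g"
proof -
  obtain f' where f': "continuous_on S f'" "\<And>x. x \<in> S \<Longrightarrow> (f has_vector_derivative f' x) (at x within S)"
    using assms(1) unfolding C1_on_def by auto
  have "(g has_vector_derivative f' x) (at x within S)" if "x \<in> S" for x
    by (rule has_vector_derivative_transform[OF that _ f'(2)[OF that]]) (simp add: assms(2))
  with f'(1) show ?thesis unfolding C1_on_def by blast
qed

lemma C1_on_sum:
  assumes "finite I" "\<And>i. i \<in> I \<Longrightarrow> C1_on S (g i)"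
  shows "C1_on S (\<lambda>x. \<Sum>i\<in>I. g i x)"
  using assms by (induction I) (auto intro: C1_on_add C1_on_const)

lemma C1_on_power: "C1_on S (\<lambda>x. of_real x ^ k)"
proof (induction k)
  case (Suc k)
  have "C1_on S (\<lambda>x. of_real x)"
    unfolding C1_on_def by (intro exI[of _ "\<lambda>_. 1"]) (auto intro!: derivative_eq_intros)
  with Suc show ?case by (simp add: C1_on_mult)
qed (simp add: C1_on_const)

text \<open>\<open>same_int\<close> is the family entering \<open>\<phi>\<^sub>k\<close>. Differentiation exchanges it with \<open>opp_int\<close>,
  and with this pairing the exponent of \<open>f\<^sup>2\<close> no longer depends on the parity of the index.\<close>

definition same_int :: "(real \<Rightarrow> complex) \<Rightarrow> nat \<Rightarrow> real \<Rightarrow> complex" where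
  "same_int f k = (if odd k then X_int f k else X_tilde f k)"

definition opp_int :: "(real \<Rightarrow> complex) \<Rightarrow> nat \<Rightarrow> real \<Rightarrow> complex" where
  "opp_int f k = (if odd k then X_tilde f k else X_int f k)"

text \<open>The parity \<open>p\<close> of the powers of \<open>t\<close> unites the two families,
  and \<open>m = 0\<close> with \<open>p = False\<close> covers the separately defined polynomial of
  index 0.\<close>

definition half_wave_poly :: "(real \<Rightarrow> complex) \<Rightarrow> bool \<Rightarrow> nat \<Rightarrow> real \<Rightarrow> real \<Rightarrow> complex" where
  "half_wave_poly f p m x t = (\<Sum>k | k \<le> m \<and> odd k = p. of_nat (m choose k) * phi f (m - k) x * of_real t ^ k)"

lemma phi_eq: "phi f k x = f x * same_int f k x"
  by (simp add: phi_def same_int_def)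

text \<open>All powers of \<open>t\<close> in the sum have the same parity. Thus the values on
  \<open>t = -x\<close> can be read off those on \<open>t = x\<close>.\<close>

lemma half_wave_poly_uminus:
  "half_wave_poly f p m x (-t) = (if p then - half_wave_poly f p m x t else half_wave_poly f p m x t)"
  unfolding half_wave_poly_def sum_negf[symmetric] if_distrib[of sum]
  by (auto simp: sum_negf[symmetric] intro!: sum.cong)

lemma wave_poly_eq:
  "wave_poly f 0 = half_wave_poly f False 0"
  "n \<ge> 1 \<Longrightarrow> wave_poly f (2 * n - 1) = half_wave_poly f False n"
  "n \<ge> 1 \<Longrightarrow> wave_poly f (2 * n) = half_wave_poly f True n"
proof -
  have "{k. k = (0::nat) \<and> even k} = {0}" by auto
  then show "wave_poly f 0 = half_wave_poly f False 0"
    by (intro ext) (simp add: wave_poly_def half_wave_poly_def)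
  show "wave_poly f (2 * n - 1) = half_wave_poly f False n" if "n \<ge> 1"
    using that by (intro ext) (simp add: wave_poly_def half_wave_poly_def)
  have "{k. 1 \<le> k \<and> k \<le> n \<and> odd k} = {k. k \<le> n \<and> odd k}" by (auto elim: oddE)
  then show "wave_poly f (2 * n) = half_wave_poly f True n" if "n \<ge> 1"
    using that by (intro ext) (simp add: wave_poly_def half_wave_poly_def)
qed

lemma c_trace_eq: "c_trace f m x = half_wave_poly f False m x x"
  using wave_poly_eq(1)[of f] wave_poly_eq(2)[of m f] by (simp add: c_trace_def)

lemma s_trace_eq: "m \<ge> 1 \<Longrightarrow> s_trace f m x = half_wave_poly f True m x x"
  using wave_poly_eq(3)[of m f] by (simp add: s_trace_def)

lemma K_approx_eq: "K_approx f N \<alpha> \<beta> x t =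
    (\<Sum>n=0..N. \<alpha> n * half_wave_poly f False n x t) + (\<Sum>n=1..N. \<beta> n * half_wave_poly f True n x t)"
proof -
  have "(\<Sum>n=1..N. \<alpha> n * wave_poly f (2 * n - 1) x t) = (\<Sum>n=1..N. \<alpha> n * half_wave_poly f False n x t)"
    "(\<Sum>n=1..N. \<beta> n * wave_poly f (2 * n) x t) = (\<Sum>n=1..N. \<beta> n * half_wave_poly f True n x t)"
    by (auto intro!: sum.cong simp: wave_poly_eq simp del: One_nat_def)
  then show ?thesis
    by (simp add: K_approx_def wave_poly_eq(1) sum.atLeast_Suc_atMost)
qed

text \<open>The recursive integrals contain negative powers of \<open>f\<close>, which is known to
  be nonzero on the interval only. They are therefore differentiated within the interval instead of
  being extended to the line.\<close>

lemma LBINT_deriv: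
  assumes "b > 0" "continuous_on {-b..b} g" "x \<in> {-b..b}"
  shows "((\<lambda>x. LBINT s=0..x. g s) has_vector_derivative (g x :: complex)) (at x within {-b..b})"
  using interval_integral_FTC2[of "-b" 0 b g x] assms by (simp add: zero_ereal_def)

section \<open>Recursive integrals and the differential equations of \<open>phi f k\<close>\<close>

locale nonvanishing_solution =
  fixes b :: real and q f f' :: "real \<Rightarrow> complex"
  assumes b_pos: "b > 0"
    and f_deriv: "x \<in> {-b..b} \<Longrightarrow> (f has_vector_derivative f' x) (at x within {-b..b})"
    and f'_deriv: "x \<in> {-b..b} \<Longrightarrow> (f' has_vector_derivative q x * f x) (at x within {-b..b})"
    and f_nz: "x \<in> {-b..b} \<Longrightarrow> f x \<noteq> 0"
begin

lemma f_cont: "continuous_on {-b..b} f"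
  unfolding continuous_on_eq_continuous_within
  by (blast intro: has_vector_derivative_continuous f_deriv)

lemma recursive_integrals_deriv:
  fixes X Y :: "real \<Rightarrow> complex"
  assumes X: "\<And>x. X x = of_nat (Suc n) * (LBINT s=0..x. Y s * ((f s)\<^sup>2) powi i)"
    and Y: "continuous_on {-b..b} Y" and x: "x \<in> {-b..b}"
  shows "(X has_vector_derivative of_nat (Suc n) * (Y x * ((f x)\<^sup>2) powi i)) (at x within {-b..b})"
proof -
  have "continuous_on {-b..b} (\<lambda>s. Y s * ((f s)\<^sup>2) powi i)"
    by (intro continuous_intros Y f_cont) (use f_nz in auto)
  from has_vector_derivative_mult_right[OF LBINT_deriv[OF b_pos this x], of "of_nat (Suc n)"]
  show ?thesis unfolding X[abs_def] .
qed

lemma X_cont: "continuous_on {-b..b} (X_int f n) \<and> continuous_on {-b..b} (X_tilde f n)"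
proof (induction n)
  case (Suc n)
  have "continuous_on {-b..b} X"
    if X: "\<And>x. X x = of_nat (Suc n) * (LBINT s=0..x. Y s * ((f s)\<^sup>2) powi i)" and Y: "continuous_on {-b..b} Y"
    for X Y :: "real \<Rightarrow> complex" and i
    unfolding continuous_on_eq_continuous_within
    by (blast intro: has_vector_derivative_continuous recursive_integrals_deriv[OF X Y])
  from this[of "X_int f (Suc n)" "X_int f n"] this[of "X_tilde f (Suc n)" "X_tilde f n"] Suc
  show ?case by (simp del: of_nat_Suc)
qed simp

lemma same_int_deriv:
  assumes "x \<in> {-b..b}"
  shows "(same_int f (Suc k) has_vector_derivative of_nat (Suc k) * opp_int f k x / (f x)\<^sup>2) (at x within {-b..b})"
proof (cases "even k")
  case True
  then have "same_int f (Suc k) = X_int f (Suc k)" "opp_int f k = X_int f k"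
    by (simp_all add: same_int_def opp_int_def)
  moreover have "(X_int f (Suc k) has_vector_derivative of_nat (Suc k) * (X_int f k x * ((f x)\<^sup>2) powi (- 1))) (at x within {-b..b})"
    by (rule recursive_integrals_deriv) (use True X_cont assms in auto)
  ultimately show ?thesis by (simp add: power_int_minus field_simps)
next
  case False
  then have "same_int f (Suc k) = X_tilde f (Suc k)" "opp_int f k = X_tilde f k"
    by (simp_all add: same_int_def opp_int_def)
  moreover have "(X_tilde f (Suc k) has_vector_derivative of_nat (Suc k) * (X_tilde f k x * ((f x)\<^sup>2) powi (- 1))) (at x within {-b..b})"
    by (rule recursive_integrals_deriv) (use False X_cont assms in auto)
  ultimately show ?thesis by (simp add: power_int_minus field_simps)
qed

lemma opp_int_deriv:
  assumes "x \<in> {-b..b}"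
  shows "(opp_int f (Suc k) has_vector_derivative of_nat (Suc k) * same_int f k x * (f x)\<^sup>2) (at x within {-b..b})"
proof (cases "even k")
  case True
  then have "opp_int f (Suc k) = X_tilde f (Suc k)" "same_int f k = X_tilde f k"
    by (simp_all add: same_int_def opp_int_def)
  moreover have "(X_tilde f (Suc k) has_vector_derivative of_nat (Suc k) * (X_tilde f k x * ((f x)\<^sup>2) powi 1)) (at x within {-b..b})"
    by (rule recursive_integrals_deriv) (use True X_cont assms in auto)
  ultimately show ?thesis by (simp add: mult.assoc)
next
  case False
  then have "opp_int f (Suc k) = X_int f (Suc k)" "same_int f k = X_int f k"
    by (simp_all add: same_int_def opp_int_def)
  moreover have "(X_int f (Suc k) has_vector_derivative of_nat (Suc k) * (X_int f k x * ((f x)\<^sup>2) powi 1)) (at x within {-b..b})"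
    by (rule recursive_integrals_deriv) (use False X_cont assms in auto)
  ultimately show ?thesis by (simp add: mult.assoc)
qed

text \<open>The derivative of \<open>phi f k\<close>, with \<open>f / f^2\<close> reduced to
  \<open>1 / f\<close> in the second term. For \<open>k = 0\<close> the truncated index
  \<open>k - 1\<close> is harmless because of the factor \<open>k\<close>.\<close>

definition "dphi k x = f' x * same_int f k x + of_nat k * opp_int f (k - 1) x * inverse (f x)"

lemma inverse_f_deriv:
  assumes "x \<in> {-b..b}"
  shows "((\<lambda>x. inverse (f x)) has_vector_derivative - f' x / (f x)\<^sup>2) (at x within {-b..b})"
proof -
  have "(inverse has_field_derivative - (inverse (f x) ^ Suc (Suc 0))) (at (f x) within f ` {-b..b})"
    using f_nz[OF assms] by (auto intro!: derivative_eq_intros)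
  from field_vector_diff_chain_within[OF f_deriv[OF assms] this]
  show ?thesis
    by (simp add: o_def divide_inverse power2_eq_square)
qed

lemma phi_deriv:
  assumes x: "x \<in> {-b..b}"
  shows "(phi f k has_vector_derivative dphi k x) (at x within {-b..b})"
proof (cases k)
  case 0
  then show ?thesis using f_deriv[OF x] by (simp add: phi_eq[abs_def] dphi_def same_int_def)
next
  case (Suc n)
  have "((\<lambda>x. f x * same_int f k x) has_vector_derivative
      f x * (of_nat (Suc n) * opp_int f n x / (f x)\<^sup>2) + f' x * same_int f k x) (at x within {-b..b})"
    unfolding Suc by (intro derivative_intros f_deriv same_int_deriv x)
  then show ?thesis
    using f_nz[OF x] by (simp add: phi_eq[abs_def] dphi_def Suc field_simps power2_eq_square del: of_nat_Suc)
qed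

text \<open>Two differentiations lower the index by two and lead through \<open>opp_int\<close> back
  to \<open>same_int\<close>, while the two terms that combine \<open>f'\<close> with
  \<open>opp_int\<close> cancel. So \<open>phi f k\<close> behaves under the Schroedinger operator
  as \<open>x ^ k\<close> does under the second derivative. For \<open>k < 2\<close> the coefficient
  vanishes and the truncated index \<open>k - 2\<close> does not matter.\<close>

lemma dphi_deriv:
  assumes x: "x \<in> {-b..b}"
  shows "(dphi k has_vector_derivative q x * phi f k x + of_nat (k * (k - 1)) * phi f (k - 2) x) (at x within {-b..b})"
proof -
  consider "k = 0" | "k = 1" | n where "k = Suc (Suc n)"
    by (metis One_nat_def not0_implies_Suc)
  then show ?thesis
  proof cases
    case 1
    then show ?thesis using f'_deriv[OF x] by (simp add: dphi_def[abs_def] phi_eq same_int_def)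
  next
    case 2
    have "((\<lambda>x. f' x * same_int f 1 x + inverse (f x)) has_vector_derivative
      (f' x * (of_nat (Suc 0) * opp_int f 0 x / (f x)\<^sup>2) + q x * f x * same_int f 1 x) + - f' x / (f x)\<^sup>2) (at x within {-b..b})"
      unfolding One_nat_def by (intro derivative_intros f'_deriv same_int_deriv inverse_f_deriv x)
    then show ?thesis
      using 2 by (simp add: dphi_def[abs_def] phi_eq opp_int_def algebra_simps)
  next
    case 3
    have "((\<lambda>x. f' x * same_int f k x + of_nat k * opp_int f (Suc n) x * inverse (f x)) has_vector_derivative
      (f' x * (of_nat k * opp_int f (Suc n) x / (f x)\<^sup>2) + q x * f x * same_int f k x)
      + (of_nat k * opp_int f (Suc n) x * (- f' x / (f x)\<^sup>2)
         + of_nat k * (of_nat (Suc n) * same_int f n x * (f x)\<^sup>2) * inverse (f x))) (at x within {-b..b})"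
      unfolding 3 by (intro derivative_intros f'_deriv same_int_deriv opp_int_deriv inverse_f_deriv x)
    moreover have "(f' x * (of_nat k * opp_int f (Suc n) x / (f x)\<^sup>2) + q x * f x * same_int f k x)
      + (of_nat k * opp_int f (Suc n) x * (- f' x / (f x)\<^sup>2)
         + of_nat k * (of_nat (Suc n) * same_int f n x * (f x)\<^sup>2) * inverse (f x)) =
      q x * phi f k x + of_nat (k * (k - 1)) * phi f (k - 2) x"
      using f_nz[OF x] unfolding 3 phi_eq
      by (simp add: field_simps power2_eq_square del: of_nat_Suc mult_Suc mult_Suc_right)
    ultimately show ?thesis
      by (simp add: dphi_def[abs_def] 3 del: of_nat_Suc)
  qed
qed

lemma phi_C1: "C1_on {-b..b} (phi f k)"
  unfolding C1_on_def
  by (intro exI[of _ "dphi k"] conjI ballI phi_deriv)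
    (auto simp: continuous_on_eq_continuous_within intro: has_vector_derivative_continuous[OF dphi_deriv])

text \<open>The left side collects the lower-order terms of the second derivatives in
  \<open>x\<close>, the right side the second derivatives in \<open>t\<close>. They match under the
  shift from \<open>k\<close> to \<open>k + 2\<close>, which preserves parity, because \<open>(m
  choose k) * (m - k) * (m - k - 1) = (m choose (k + 2)) * (k + 2) * (k + 1)\<close>. The summands
  outside the common range have a zero coefficient.\<close>

lemma wave_sum_telescope:
  "(\<Sum>k | k \<le> m \<and> odd k = p. of_nat (m choose k) * (of_nat ((m - k) * (m - k - 1)) * phi f (m - k - 2) x) * of_real t ^ k) =
   (\<Sum>k | k \<le> m \<and> odd k = p. of_nat (m choose k) * phi f (m - k) x * (of_nat (k * (k - 1)) * of_real t ^ (k - 2)))"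
    (is "sum ?l ?S = sum ?r ?S")
proof -
  have "sum ?l ?S = sum ?l {k. k + 2 \<le> m \<and> odd k = p}"
  proof (rule sum.mono_neutral_right)
    show "\<forall>i\<in>?S - {k. k + 2 \<le> m \<and> odd k = p}. ?l i = 0"
    proof
      fix i assume "i \<in> ?S - {k. k + 2 \<le> m \<and> odd k = p}"
      then have "m - i = 0 \<or> m - i = 1" by auto
      then show "?l i = 0" by auto
    qed
  qed auto
  also have "\<dots> = sum ?r {k. 2 \<le> k \<and> k \<le> m \<and> odd k = p}"
  proof (rule sum.reindex_bij_witness[of _ "\<lambda>k. k - 2" "\<lambda>k. k + 2"])
    fix k assume "k \<in> {k. k + 2 \<le> m \<and> odd k = p}"
    then have k: "k + 2 \<le> m" by simp
    have step: "(m - j) * (m choose j) = Suc j * (m choose Suc j)" for j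
      by (simp only: binomial_absorb_comp binomial_absorption)
    have e: "k + 2 = Suc (Suc k)" "Suc (Suc k) - 1 = Suc k" by simp_all
    have "(m choose k) * ((m - k) * (m - k - 1)) = (m - Suc k) * ((m - k) * (m choose k))"
      by (simp add: mult_ac)
    also have "\<dots> = Suc k * ((m - Suc k) * (m choose Suc k))"
      unfolding step[of k] by (simp only: mult_ac)
    also have "\<dots> = (m choose (k + 2)) * ((k + 2) * (k + 2 - 1))"
      unfolding step[of "Suc k"] e by (simp only: mult_ac)
    finally have c: "of_nat (m choose k) * of_nat ((m - k) * (m - k - 1)) =
      (of_nat (m choose (k + 2)) * of_nat ((k + 2) * (k + 2 - 1)) :: complex)"
      unfolding of_nat_mult[symmetric] by (rule arg_cong)
    have m: "m - (k + 2) = m - k - 2" "k + 2 - 2 = k" by simp_all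
    have "?r (k + 2) = (of_nat (m choose (k + 2)) * of_nat ((k + 2) * (k + 2 - 1))) * (phi f (m - k - 2) x * of_real t ^ k)"
      unfolding m by (simp only: mult_ac)
    also have "\<dots> = ?l k"
      unfolding c[symmetric] by (simp only: mult_ac)
    finally show "?r (k + 2) = ?l k" .
  qed auto
  also have "\<dots> = sum ?r ?S"
  proof (rule sum.mono_neutral_left)
    show "\<forall>i\<in>?S - {k. 2 \<le> k \<and> k \<le> m \<and> odd k = p}. ?r i = 0"
    proof
      fix i assume "i \<in> ?S - {k. 2 \<le> k \<and> k \<le> m \<and> odd k = p}"
      then have "i = 0 \<or> i = 1" by auto
      then show "?r i = 0" by auto
    qed
  qed auto
  finally show ?thesis .
qed

text \<open>The mixed derivative of \<open>A (u + v) * B (u - v)\<close> is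
  \<open>A'' B - A B''\<close>, the terms with one derivative on each factor cancelling. In the sum,
  \<open>wave_sum_telescope\<close> removes everything except the contribution of
  \<open>q\<close>.\<close>

lemma wave_sol_half_wave_poly: "wave_sol b q (\<lambda>u v. half_wave_poly f p m (u + v) (u - v))"
proof (rule wave_solI)
  have at: "at z within {-b..b} = at z" if "\<bar>z\<bar> < b" for z
    using that by (intro at_within_interior) (auto simp: abs_less_iff)
  have dpow: "((\<lambda>y. of_real (g y) ^ k) has_vector_derivative (of_nat k * of_real (g y) ^ (k - 1) * of_real c :: complex)) (at y)"
    if "(g has_real_derivative c) (at y)" for g c y and k
    using has_vector_derivative_of_real[OF DERIV_power[OF that, of k], where 'a = complex] by (simp add: mult_ac)
  have dpow_v: "((\<lambda>v. of_real (u - v) ^ k) has_vector_derivative (- (of_nat k * of_real (u - v) ^ (k - 1)) :: complex)) (at v)"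
    for u v :: real and k
  proof -
    have "((\<lambda>v. u - v) has_real_derivative -1) (at v)" by (auto intro!: derivative_eq_intros)
    from dpow[OF this, of k] show ?thesis by simp
  qed
  have dpow_u: "((\<lambda>u. of_real (u - v) ^ k) has_vector_derivative (of_nat k * of_real (u - v) ^ (k - 1) :: complex)) (at u)"
    for u v :: real and k
  proof -
    have "((\<lambda>u. u - v) has_real_derivative 1) (at u)" by (auto intro!: derivative_eq_intros)
    from dpow[OF this, of k] show ?thesis by simp
  qed
  {
    fix u v :: real assume uv: "\<bar>u\<bar> + \<bar>v\<bar> < b"
    have z: "u + v \<in> {-b..b}" "v + u \<in> {-b..b}" "\<bar>u + v\<bar> < b" using uv by auto
    show "((\<lambda>v. half_wave_poly f p m (u + v) (u - v)) has_vector_derivative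
      (\<Sum>k | k \<le> m \<and> odd k = p. of_nat (m choose k) *
        (phi f (m - k) (u + v) * - (of_nat k * of_real (u - v) ^ (k - 1)) + dphi (m - k) (u + v) * of_real (u - v) ^ k))) (at v)"
      unfolding half_wave_poly_def mult.assoc
      by (intro has_vector_derivative_sum has_vector_derivative_mult_right has_vector_derivative_mult
          has_vector_derivative_shift(1)[of "phi f _"] dpow_v phi_deriv[OF z(1), unfolded at[OF z(3)]])
    \<comment> \<open>The variable is now \<open>u\<close>, and \<open>v + u\<close> is the shape to
      which \<open>has_vector_derivative_shift\<close> applies.\<close>
    have "((\<lambda>u. \<Sum>k | k \<le> m \<and> odd k = p. of_nat (m choose k) *
        (phi f (m - k) (v + u) * - (of_nat k * of_real (u - v) ^ (k - 1)) + dphi (m - k) (v + u) * of_real (u - v) ^ k))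
      has_vector_derivative (\<Sum>k | k \<le> m \<and> odd k = p. of_nat (m choose k) *
        ((phi f (m - k) (v + u) * - (of_nat k * (of_nat (k - 1) * of_real (u - v) ^ (k - 1 - 1))) +
           dphi (m - k) (v + u) * - (of_nat k * of_real (u - v) ^ (k - 1)))
         + (dphi (m - k) (v + u) * (of_nat k * of_real (u - v) ^ (k - 1)) +
           (q (v + u) * phi f (m - k) (v + u) + of_nat ((m - k) * (m - k - 1)) * phi f (m - k - 2) (v + u)) * of_real (u - v) ^ k)))) (at u)"
      using z(3)
      by (intro has_vector_derivative_sum has_vector_derivative_mult_right has_vector_derivative_mult has_vector_derivative_add
          has_vector_derivative_minus
          has_vector_derivative_shift(1)[of "phi f _"] has_vector_derivative_shift(1)[of "dphi _"] dpow_u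
          phi_deriv[OF z(2), unfolded at[OF z(3)[unfolded add.commute[of u v]]]]
          dphi_deriv[OF z(2), unfolded at[OF z(3)[unfolded add.commute[of u v]]]])
    moreover have "(\<Sum>k | k \<le> m \<and> odd k = p. of_nat (m choose k) *
        ((phi f (m - k) (v + u) * - (of_nat k * (of_nat (k - 1) * of_real (u - v) ^ (k - 1 - 1))) +
           dphi (m - k) (v + u) * - (of_nat k * of_real (u - v) ^ (k - 1)))
         + (dphi (m - k) (v + u) * (of_nat k * of_real (u - v) ^ (k - 1)) +
           (q (v + u) * phi f (m - k) (v + u) + of_nat ((m - k) * (m - k - 1)) * phi f (m - k - 2) (v + u)) * of_real (u - v) ^ k)))
      = q (v + u) * half_wave_poly f p m (v + u) (u - v)"
    proof -
      have "(\<Sum>k | k \<le> m \<and> odd k = p. of_nat (m choose k) *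
        ((phi f (m - k) (v + u) * - (of_nat k * (of_nat (k - 1) * of_real (u - v) ^ (k - 1 - 1))) +
           dphi (m - k) (v + u) * - (of_nat k * of_real (u - v) ^ (k - 1)))
         + (dphi (m - k) (v + u) * (of_nat k * of_real (u - v) ^ (k - 1)) +
           (q (v + u) * phi f (m - k) (v + u) + of_nat ((m - k) * (m - k - 1)) * phi f (m - k - 2) (v + u)) * of_real (u - v) ^ k))) =
        (\<Sum>k | k \<le> m \<and> odd k = p. q (v + u) * (of_nat (m choose k) * phi f (m - k) (v + u) * of_real (u - v) ^ k)
          + (of_nat (m choose k) * (of_nat ((m - k) * (m - k - 1)) * phi f (m - k - 2) (v + u)) * of_real (u - v) ^ k
           - of_nat (m choose k) * phi f (m - k) (v + u) * (of_nat (k * (k - 1)) * of_real (u - v) ^ (k - 2))))"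
        by (intro sum.cong refl) (simp add: ring_distribs mult_ac numeral_2_eq_2)
      then show ?thesis
        unfolding sum.distrib sum_subtractf wave_sum_telescope
        by (simp add: half_wave_poly_def sum_distrib_left)
    qed
    ultimately show "((\<lambda>u. \<Sum>k | k \<le> m \<and> odd k = p. of_nat (m choose k) *
        (phi f (m - k) (u + v) * - (of_nat k * of_real (u - v) ^ (k - 1)) + dphi (m - k) (u + v) * of_real (u - v) ^ k))
      has_vector_derivative q (u + v) * half_wave_poly f p m (u + v) (u - v)) (at u)"
      by (simp add: add.commute)
  }
  have "continuous_on (diamond b) (\<lambda>z. half_wave_poly f p m (fst z + snd z) (fst z - snd z))"
    unfolding half_wave_poly_def
    by (intro continuous_intros continuous_on_compose2[OF C1_on_imp_continuous[OF phi_C1]])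
      (auto simp: diamond_def abs_le_iff)
  then show "continuous_on (diamond b) (\<lambda>(u, v). half_wave_poly f p m (u + v) (u - v))"
    by (simp add: case_prod_beta)
qed

lemma half_wave_poly_C1: "C1_on {-b..b} (\<lambda>x. half_wave_poly f p m x x)"
  unfolding half_wave_poly_def
  by (intro C1_on_sum C1_on_mult C1_on_cmult phi_C1 C1_on_power C1_on_const) auto

lemma wave_sol_K_approx: "wave_sol b q (\<lambda>u v. K_approx f N \<alpha> \<beta> (u + v) (u - v))"
  unfolding K_approx_eq
  by (intro wave_sol_add wave_sol_sum wave_sol_cmult wave_sol_half_wave_poly) auto

lemma K_approx_C1:
  "C1_on {-b..b} (\<lambda>x. K_approx f N \<alpha> \<beta> x x)" "C1_on {-b..b} (\<lambda>x. K_approx f N \<alpha> \<beta> x (- x))"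
proof -
  have "C1_on {-b..b} (\<lambda>x. half_wave_poly f p m x (- x))" for p m
    using C1_on_cmult[OF half_wave_poly_C1, of "-1" p m] half_wave_poly_C1[of p m]
    by (cases p) (simp_all add: half_wave_poly_uminus)
  then show "C1_on {-b..b} (\<lambda>x. K_approx f N \<alpha> \<beta> x x)" "C1_on {-b..b} (\<lambda>x. K_approx f N \<alpha> \<beta> x (- x))"
    unfolding K_approx_eq by (intro C1_on_add C1_on_sum C1_on_cmult half_wave_poly_C1; simp)+
qed

end

section \<open>Transmutation of functions of one characteristic variable\<close>

context goursat_kernel
begin

text \<open>The image under \<open>T\<^sub>f\<close> of \<open>s \<mapsto> g ((s + t) / 2)\<close> in characteristic coordinates (see
  \<open>kernel_transmuted\<close>); that of \<open>s \<mapsto> g ((s - t) / 2)\<close> is \<open>transmuted g v u\<close>.\<close>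

definition "transmuted g u v = g u + 2 * oint (-v) u (\<lambda>r. H (r + v) (u - r) * g r)"

definition "transmuted\<^sub>v g u v = h * g (-v) + 2 * oint (-v) u (\<lambda>r. H\<^sub>u (r + v) (u - r) * g r)"

lemma transmuted_cont:
  assumes g: "continuous_on UNIV g"
  shows "continuous_on S (\<lambda>p. transmuted g (fst p) (snd p))"
  unfolding transmuted_def
  by (intro continuous_intros oint_cont_UNIV cont_comp2[OF H_cont] continuous_on_compose2[OF g] subset_UNIV)

text \<open>In \<open>g\<close> the variable \<open>v\<close> occurs only through the lower limit,
  so continuity of \<open>g\<close> suffices. That limit contributes
  \<open>H 0 (u + v) = h / 2\<close>, doubled by the factor before the integral.\<close>

lemma deriv_transmuted_v:
  assumes g: "continuous_on UNIV g"
  shows "((\<lambda>v. transmuted g u v) has_vector_derivative transmuted\<^sub>v g u v) (at v)"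
proof -
  have "((\<lambda>v. oint (-v) u (\<lambda>r. H (r + v) (u - r) * g r)) has_vector_derivative
     0 *\<^sub>R (H (u + v) (u - u) * g u) - (-1) *\<^sub>R (H (-v + v) (u - (-v)) * g (-v))
     + oint (-v) u (\<lambda>r. H\<^sub>u (r + v) (u - r) * g r)) (at v)"
  proof (rule oint_leibniz[where F = "\<lambda>v r. H (r + v) (u - r) * g r"])
    show "((\<lambda>y. H (r + y) (u - r) * g r) has_vector_derivative H\<^sub>u (r + y) (u - r) * g r) (at y)" for y r
      by (intro has_vector_derivative_mult_left has_vector_derivative_shift(1)[of "\<lambda>z. H z (u - r)"] deriv_H_u)
  qed (unfold case_prod_beta, (intro continuous_intros cont_comp2[OF H_cont] cont_comp2[OF H\<^sub>u_cont]
        continuous_on_compose2[OF g] subset_UNIV derivative_eq_intros; simp)+)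
  then have "((\<lambda>v. g u + 2 * oint (-v) u (\<lambda>r. H (r + v) (u - r) * g r)) has_vector_derivative
     0 + 2 * (h / 2 * g (-v) + oint (-v) u (\<lambda>r. H\<^sub>u (r + v) (u - r) * g r))) (at v)"
    by (intro derivative_intros) (simp add: H_0v)
  then show ?thesis
    by (simp add: transmuted_def transmuted\<^sub>v_def algebra_simps)
qed

text \<open>Along the path of integration the two arguments have the constant sum
  \<open>u + v\<close>, so the potential can leave the integral. Their difference is at most
  \<open>\<bar>u + v\<bar>\<close> in absolute value, which keeps the path inside the
  diamond.\<close>

lemma oint_G_eq:
  assumes "\<bar>u + v\<bar> \<le> b"
  shows "oint (-v) u (\<lambda>r. G (r + v) (u - r) * g r) = q (u + v) * oint (-v) u (\<lambda>r. H (r + v) (u - r) * g r)"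
proof -
  have "oint (-v) u (\<lambda>r. G (r + v) (u - r) * g r) = oint (-v) u (\<lambda>r. q (u + v) * (H (r + v) (u - r) * g r))"
  proof (rule oint_cong)
    fix r assume "min (-v) u \<le> r" "r \<le> max (-v) u"
    then have "\<bar>2 * r + v - u\<bar> \<le> \<bar>u + v\<bar>" by linarith
    with assms have "\<bar>r + v + (u - r)\<bar> \<le> b" "\<bar>r + v - (u - r)\<bar> \<le> b" by linarith+
    then have "(r + v, u - r) \<in> diamond b" by (simp add: diamond_def)
    then show "G (r + v) (u - r) * g r = q (u + v) * (H (r + v) (u - r) * g r)"
      using G_eq by (simp add: add.commute)
  qed
  then show ?thesis by (simp add: oint_cmult)
qed

lemma deriv_transmuted\<^sub>v_u:
  assumes g: "continuous_on UNIV g" and uv: "\<bar>u + v\<bar> \<le> b"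
  shows "((\<lambda>u. transmuted\<^sub>v g u v) has_vector_derivative q (u + v) * transmuted g u v) (at u)"
proof -
  have "((\<lambda>u. oint (-v) u (\<lambda>r. H\<^sub>u (r + v) (u - r) * g r)) has_vector_derivative
     1 *\<^sub>R (H\<^sub>u (u + v) (u - u) * g u) - 0 *\<^sub>R (H\<^sub>u (-v + v) (u - (-v)) * g (-v))
     + oint (-v) u (\<lambda>r. G (r + v) (u - r) * g r)) (at u)"
  proof (rule oint_leibniz[where F = "\<lambda>u r. H\<^sub>u (r + v) (u - r) * g r"])
    show "((\<lambda>y. H\<^sub>u (r + v) (y - r) * g r) has_vector_derivative G (r + v) (y - r) * g r) (at y)" for y r
      by (intro has_vector_derivative_mult_left has_vector_derivative_shift(2)[of "\<lambda>z. H\<^sub>u (r + v) z"] deriv_H\<^sub>u_v)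
  qed (unfold case_prod_beta, (intro continuous_intros cont_comp2[OF G_cont] cont_comp2[OF H\<^sub>u_cont]
        continuous_on_compose2[OF g] subset_UNIV derivative_eq_intros; simp)+)
  \<comment> \<open>The upper limit contributes \<open>H\<^sub>u (u + v) 0 = q (u + v) / 2\<close>.
    Doubled, this is exactly the term \<open>q (u + v) * g u\<close> that the free summand of
    \<open>transmuted\<close> demands: the Goursat condition on \<open>v = 0\<close> is chosen for
    it.\<close>
  then have "((\<lambda>u. h * g (-v) + 2 * oint (-v) u (\<lambda>r. H\<^sub>u (r + v) (u - r) * g r)) has_vector_derivative
     0 + 2 * (q (u + v) / 2 * g u + q (u + v) * oint (-v) u (\<lambda>r. H (r + v) (u - r) * g r))) (at u)"
    by (intro derivative_intros) (simp add: H\<^sub>u_u0 oint_G_eq[OF uv])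
  then show ?thesis
    by (simp add: transmuted_def transmuted\<^sub>v_def algebra_simps)
qed

lemma wave_sol_transmuted:
  assumes g: "continuous_on UNIV g"
  shows "wave_sol b q (transmuted g)"
proof (rule wave_solI[of _ _ "transmuted\<^sub>v g"])
  show "continuous_on (diamond b) (\<lambda>(u, v). transmuted g u v)"
    using transmuted_cont[OF g] by (simp add: case_prod_beta)
qed (auto intro!: deriv_transmuted_v deriv_transmuted\<^sub>v_u g)

text \<open>The derivative in \<open>v\<close> now meets the free summand \<open>g v\<close>, hence
  the differentiability assumption on \<open>g\<close>; the term \<open>g' v\<close> disappears
  again under the derivative in \<open>u\<close>. The Goursat conditions enter through
  \<open>H\<^sub>v\<close> on \<open>u = 0\<close> and \<open>H\<^sub>u\<close> on
  \<open>v = 0\<close>.\<close>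

lemma wave_sol_transmuted_swap:
  assumes g: "continuous_on UNIV g"
    and dg: "\<And>x. \<bar>x\<bar> < b \<Longrightarrow> (g has_vector_derivative g' x) (at x)"
  shows "wave_sol b q (\<lambda>u v. transmuted g v u)"
proof (rule wave_solI)
  show "continuous_on (diamond b) (\<lambda>(u, v). transmuted g v u)"
    using continuous_on_compose2[OF transmuted_cont[OF g, of UNIV], of "diamond b" "\<lambda>p. (snd p, fst p)"]
    by (simp add: case_prod_beta continuous_intros)
next
  fix u v :: real assume uv: "\<bar>u\<bar> + \<bar>v\<bar> < b"
  have "((\<lambda>v. oint (-u) v (\<lambda>r. H (r + u) (v - r) * g r)) has_vector_derivative
     1 *\<^sub>R (H (v + u) (v - v) * g v) - 0 *\<^sub>R (H (-u + u) (v - (-u)) * g (-u))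
     + oint (-u) v (\<lambda>r. H\<^sub>v (r + u) (v - r) * g r)) (at v)"
  proof (rule oint_leibniz[where F = "\<lambda>v r. H (r + u) (v - r) * g r"])
    show "((\<lambda>y. H (r + u) (y - r) * g r) has_vector_derivative H\<^sub>v (r + u) (y - r) * g r) (at y)" for y r
      by (intro has_vector_derivative_mult_left has_vector_derivative_shift(2)[of "\<lambda>z. H (r + u) z"] deriv_H_v)
  qed (unfold case_prod_beta, (intro continuous_intros cont_comp2[OF H_cont] cont_comp2[OF H\<^sub>v_cont]
        continuous_on_compose2[OF g] subset_UNIV derivative_eq_intros; simp)+)
  then have "((\<lambda>v. g v + 2 * oint (-u) v (\<lambda>r. H (r + u) (v - r) * g r)) has_vector_derivative
     g' v + 2 * (H (v + u) 0 * g v + oint (-u) v (\<lambda>r. H\<^sub>v (r + u) (v - r) * g r))) (at v)"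
    using uv by (intro derivative_intros dg) auto
  then show "((\<lambda>y. transmuted g y u) has_vector_derivative
     g' v + 2 * (H (v + u) 0 * g v + oint (-u) v (\<lambda>r. H\<^sub>v (r + u) (v - r) * g r))) (at v)"
    by (simp add: transmuted_def)
next
  fix u v :: real assume uv: "\<bar>u\<bar> + \<bar>v\<bar> < b"
  have "((\<lambda>u. oint (-u) v (\<lambda>r. H\<^sub>v (r + u) (v - r) * g r)) has_vector_derivative
     0 *\<^sub>R (H\<^sub>v (v + u) (v - v) * g v) - (-1) *\<^sub>R (H\<^sub>v (-u + u) (v - (-u)) * g (-u))
     + oint (-u) v (\<lambda>r. G (r + u) (v - r) * g r)) (at u)"
  proof (rule oint_leibniz[where F = "\<lambda>u r. H\<^sub>v (r + u) (v - r) * g r"])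
    show "((\<lambda>y. H\<^sub>v (r + y) (v - r) * g r) has_vector_derivative G (r + y) (v - r) * g r) (at y)" for y r
      by (intro has_vector_derivative_mult_left has_vector_derivative_shift(1)[of "\<lambda>z. H\<^sub>v z (v - r)"] deriv_H\<^sub>v_u)
  qed (unfold case_prod_beta, (intro continuous_intros cont_comp2[OF G_cont] cont_comp2[OF H\<^sub>v_cont]
        continuous_on_compose2[OF g] subset_UNIV derivative_eq_intros; simp)+)
  moreover have "((\<lambda>u. H (v + u) 0) has_vector_derivative H\<^sub>u (v + u) 0) (at u)"
    by (intro has_vector_derivative_shift(1)[of "\<lambda>z. H z 0"] deriv_H_u)
  moreover have "\<bar>v + u\<bar> \<le> b" using uv by linarith
  ultimately have "((\<lambda>u. g' v + 2 * (H (v + u) 0 * g v + oint (-u) v (\<lambda>r. H\<^sub>v (r + u) (v - r) * g r))) has_vector_derivative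
     0 + 2 * (H\<^sub>u (v + u) 0 * g v + q (v + u) * oint (-u) v (\<lambda>r. H (r + u) (v - r) * g r))) (at u)"
    by (intro derivative_intros) (simp_all add: H\<^sub>v_0v oint_G_eq)
  then show "((\<lambda>u. g' v + 2 * (H (v + u) 0 * g v + oint (-u) v (\<lambda>r. H\<^sub>v (r + u) (v - r) * g r))) has_vector_derivative
     q (u + v) * transmuted g v u) (at u)"
    by (simp add: transmuted_def H\<^sub>u_u0 algebra_simps)
qed

text \<open>The substitution is \<open>s = 2 * r - t\<close>, the origin of the factor 2 in
  \<open>transmuted\<close>. Replacing \<open>t\<close> by \<open>-t\<close> exchanges the
  characteristic coordinates, so waves travelling in the other direction are covered too.\<close>

lemma kernel_transmuted:
  assumes g: "continuous_on UNIV g"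
  shows "g ((x + t) / 2) + oint (-x) x (\<lambda>s. K_kernel H x s * g ((s + t) / 2)) =
    transmuted g ((x + t) / 2) ((x - t) / 2)"
proof -
  have "oint (2 * ((t - x) / 2) + (- t)) (2 * ((x + t) / 2) + (- t)) (\<lambda>s. K_kernel H x s * g ((s + t) / 2)) =
     of_real 2 * oint ((t - x) / 2) ((x + t) / 2)
       (\<lambda>r. K_kernel H x (2 * r + (- t)) * g ((2 * r + (- t) + t) / 2))"
    unfolding K_kernel_def
    by (intro oint_affine continuous_intros cont_comp2[OF H_cont] continuous_on_compose2[OF g] subset_UNIV) auto
  moreover have "K_kernel H x (2 * r + (- t)) = H (r + (x - t) / 2) ((x + t) / 2 - r)" for r
    by (simp add: K_kernel_def field_simps)
  moreover have "2 * ((t - x) / 2) + (- t) = - x" "2 * ((x + t) / 2) + (- t) = x" "(t - x) / 2 = - ((x - t) / 2)"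
    by (simp_all add: diff_divide_distrib add_divide_distrib)
  ultimately show ?thesis
    unfolding transmuted_def by simp
qed

end

section \<open>The operators on function spaces\<close>

lemma C1_space_restrict: "restrict g {-b..b} \<in> C1_space b \<longleftrightarrow> C1_on {-b..b} g"
proof -
  have "C1_on {-b..b} (restrict g {-b..b}) \<longleftrightarrow> C1_on {-b..b} g"
    by (auto intro: C1_on_cong)
  then show ?thesis by (simp add: C1_space_def C1_on_def)
qed

lemma norm_le_max_norm:
  assumes "\<And>x. x \<in> {-b..b} \<Longrightarrow> norm (g x) \<le> C" "x \<in> {-b..b}"
  shows "norm (g x) \<le> max_norm b g"
  unfolding max_norm_def using assms by (intro cSUP_upper bdd_aboveI2) auto

lemma max_norm_le:
  assumes "b > 0" "\<And>x. x \<in> {-b..b} \<Longrightarrow> norm (g x) \<le> C"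
  shows "max_norm b g \<le> C"
  unfolding max_norm_def using assms by (intro cSUP_least) auto

lemma norm_le_pair_norm:
  assumes "continuous_on {-b..b} \<phi>" "continuous_on {-b..b} \<psi>" "x \<in> {-b..b}"
  shows "norm (\<phi> x) \<le> pair_norm b (\<phi>, \<psi>)" "norm (\<psi> x) \<le> pair_norm b (\<phi>, \<psi>)"
proof -
  have *: "norm (g x) \<le> max_norm b g" if g: "continuous_on {-b..b} g" for g :: "real \<Rightarrow> complex"
  proof -
    obtain C where "\<And>x. x \<in> {-b..b} \<Longrightarrow> norm (g x) \<le> C"
      using compact_imp_bounded[OF compact_continuous_image[OF g compact_Icc]]
      unfolding bounded_iff by blast
    then show ?thesis using assms(3) by (rule norm_le_max_norm)
  qed
  show "norm (\<phi> x) \<le> pair_norm b (\<phi>, \<psi>)" "norm (\<psi> x) \<le> pair_norm b (\<phi>, \<psi>)"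
    using *[OF assms(1)] *[OF assms(2)] by (auto simp: pair_norm_def)
qed

locale transmutation = goursat_kernel b q h H H\<^sub>u H\<^sub>v G + nonvanishing_solution b q f f'
  for b q h H H\<^sub>u H\<^sub>v G f f' +
  assumes f_0: "f 0 = 1" and f'_0: "f' 0 = h"
begin

abbreviation "K \<equiv> K_kernel H"

lemma zero_mem: "0 \<in> {-b..b}" using b_pos by simp

text \<open>\<open>T\<^sub>f 1\<close> solves the same initial value problem as \<open>f\<close>. As \<open>f\<close> has no zeros, the vanishing
  Wronskian makes the quotient of the two constant.\<close>

lemma kernel_one:
  assumes x: "x \<in> {-b..b}"
  shows "1 + oint (-x) x (K_kernel H x) = f x"
proof -
  define F where "F = (\<lambda>x. 1 + oint (-x) x (K_kernel H x))"
  define P where "P = (\<lambda>x. transmuted\<^sub>v (\<lambda>_. 1) x 0)"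
  \<comment> \<open>For the constant function 1 the transmuted function depends on
    \<open>u + v\<close> alone. Its partial derivatives are thus derivatives of \<open>F\<close>,
    and the second-order equation for \<open>F\<close> comes from the lemmas on
    \<open>transmuted\<close> at \<open>v = 0\<close>.\<close>
  have F: "transmuted (\<lambda>_. 1) u v = F (u + v)" for u v
    using kernel_transmuted[of "\<lambda>_. 1" "u + v" "u - v"] by (simp add: F_def continuous_intros)
  have dF: "(F has_vector_derivative P x) (at x)" for x
  proof -
    have "((\<lambda>v. F (x + v)) has_vector_derivative P x) (at (x - x))"
      using deriv_transmuted_v[where g = "\<lambda>_. 1" and u = x and v = 0] by (simp add: F P_def continuous_intros)
    from has_vector_derivative_shift(2)[OF this] show ?thesis by simp
  qed
  have dP: "(P has_vector_derivative q x * F x) (at x)" if "x \<in> {-b..b}" for x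
    using deriv_transmuted\<^sub>v_u[where g = "\<lambda>_. 1" and u = x and v = 0] that by (simp add: F P_def abs_le_iff)
  note 0 = zero_mem
  have W0: "F 0 * f' 0 - P 0 * f 0 = 0"
    by (simp add: f_0 f'_0 F_def P_def transmuted\<^sub>v_def)
  have dW: "((\<lambda>x. F x * f' x - P x * f x) has_vector_derivative 0) (at x within {-b..b})"
    if x: "x \<in> {-b..b}" for x
  proof -
    have "((\<lambda>x. F x * f' x - P x * f x) has_vector_derivative
      (F x * (q x * f x) + P x * f' x) - (P x * f' x + q x * F x * f x)) (at x within {-b..b})"
      using x by (intro derivative_intros f_deriv f'_deriv has_vector_derivative_at_within[OF dF] has_vector_derivative_at_within[OF dP])
    then show ?thesis
      by (simp add: mult_ac)
  qed
  obtain c where c: "\<And>x. x \<in> {-b..b} \<Longrightarrow> F x * f' x - P x * f x = c"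
    using has_vector_derivative_zero_constant[OF _ dW] by auto
  have W: "F x * f' x = P x * f x" if "x \<in> {-b..b}" for x
    using c[OF that] c[OF 0] W0 by simp
  have dR: "((\<lambda>x. F x * inverse (f x)) has_vector_derivative 0) (at x within {-b..b})"
    if x: "x \<in> {-b..b}" for x
  proof -
    have "((\<lambda>x. F x * inverse (f x)) has_vector_derivative
        F x * (- f' x / (f x)\<^sup>2) + P x * inverse (f x)) (at x within {-b..b})"
      using x by (intro derivative_intros has_vector_derivative_at_within[OF dF] inverse_f_deriv)
    moreover have "F x * (- f' x / (f x)\<^sup>2) + P x * inverse (f x) = 0"
      using W[OF x] f_nz[OF x] by (simp add: field_simps power2_eq_square)
    ultimately show ?thesis by simp
  qed
  obtain d where d: "\<And>x. x \<in> {-b..b} \<Longrightarrow> F x * inverse (f x) = d"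
    using has_vector_derivative_zero_constant[OF _ dR] by auto
  have "F x * inverse (f x) = F 0 * inverse (f 0)"
    using d[OF x] d[OF 0] by simp
  then show ?thesis
    using f_nz[OF x] f_0 by (simp add: F_def field_simps)
qed

lemma f_C1: "C1_on {-b..b} f"
  unfolding C1_on_def
  by (intro exI[of _ f'] conjI ballI f_deriv)
    (auto simp: continuous_on_eq_continuous_within intro: has_vector_derivative_continuous[OF f'_deriv])

lemma transmuted_one:
  assumes "x \<in> {-b..b}"
  shows "transmuted (\<lambda>_. 1) x 0 = f x" "transmuted (\<lambda>_. 1) 0 x = f x"
  using kernel_one[OF assms]
    kernel_transmuted[of "\<lambda>_. 1" x x] kernel_transmuted[of "\<lambda>_. 1" x "-x"]
  by (simp_all add: continuous_intros)

section \<open>The operator \<open>T_f\<close> and its norm\<close>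

lemma K_cont: "continuous_on UNIV (\<lambda>(x, t). K x t)"
  unfolding K_kernel_def case_prod_beta by (intro cont_comp2[OF H_cont] continuous_intros) auto

lemma T_f_eq:
  assumes "x \<in> {-b..b}" "\<And>x. x \<in> {-b..b} \<Longrightarrow> g x = g' x"
  shows "T_f b K g x = g' x + oint (-x) x (\<lambda>t. K x t * g' t)"
proof -
  have "oint (-x) x (\<lambda>t. K x t * g t) = oint (-x) x (\<lambda>t. K x t * g' t)"
    using assms by (intro oint_cong) (auto simp: min_def max_def split: if_splits)
  then show ?thesis using assms by (simp add: T_f_def oint_def)
qed

text \<open>This makes the supremum in \<open>op_norm\<close> genuine. The constant is 1 for the
  identity plus a bound of the kernel times the length \<open>2 * b\<close>.\<close>

lemma T_f_bounded:
  obtains C where "\<And>g x. \<lbrakk>continuous_on {-b..b} g; \<And>x. x \<in> {-b..b} \<Longrightarrow> norm (g x) \<le> 1; x \<in> {-b..b}\<rbrakk>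
    \<Longrightarrow> norm (T_f b K g x) \<le> C"
proof -
  obtain M where M: "M > 0"
    "\<And>x t. x \<in> {-b..b} \<Longrightarrow> t \<in> {-b..b} \<Longrightarrow> norm (K x t) \<le> M \<and> norm (K x t) \<le> M"
    using kernels_bounded[OF K_cont K_cont] by metis
  show thesis
  proof (rule that[of "1 + M * (2 * b)"])
    fix g :: "real \<Rightarrow> complex" and x
    assume g: "continuous_on {-b..b} g" "\<And>x. x \<in> {-b..b} \<Longrightarrow> norm (g x) \<le> 1" and x: "x \<in> {-b..b}"
    obtain g' where g': "continuous_on UNIV g'" "\<And>x. x \<in> {-b..b} \<Longrightarrow> g' x = g x"
      using compact_extension[OF compact_Icc g(1)] by metis
    have "norm (oint (-x) x (\<lambda>t. K x t * g' t)) \<le> M * \<bar>x - (-x)\<bar>"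
    proof (rule oint_norm_le)
      show "continuous_on UNIV (\<lambda>t. K x t * g' t)"
        by (intro continuous_intros cont_comp2[OF K_cont] g')
      fix r assume "min (-x) x \<le> r" "r \<le> max (-x) x"
      with x have r: "r \<in> {-b..b}" by (auto simp: min_def max_def split: if_splits)
      have "norm (K x r) * norm (g' r) \<le> M * 1"
        using M x r g g' by (intro mult_mono) auto
      then show "norm (K x r * g' r) \<le> M" by (simp add: norm_mult)
    qed
    also have "\<dots> \<le> M * (2 * b)" using x M by (intro mult_left_mono) auto
    finally have "norm (oint (-x) x (\<lambda>t. K x t * g' t)) \<le> M * (2 * b)" .
    moreover have "T_f b K g x = g' x + oint (-x) x (\<lambda>t. K x t * g' t)"
      using g'(2) by (intro T_f_eq x) auto
    moreover have "norm (g' x) \<le> 1" using g g' x by simp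
    ultimately show "norm (T_f b K g x) \<le> 1 + M * (2 * b)"
      using norm_triangle_ineq[of "g' x" "oint (-x) x (\<lambda>t. K x t * g' t)"] by (simp del: norm_triangle_ineq)
  qed
qed

text \<open>\<open>op_norm\<close> ranges over the unit ball, so \<open>g\<close> is divided by
  \<open>c\<close>. The case \<open>c = 0\<close> escapes this scaling, but there \<open>g\<close>
  vanishes on the interval.\<close>

lemma T_f_norm_le:
  assumes g: "continuous_on {-b..b} g" and c: "\<And>x. x \<in> {-b..b} \<Longrightarrow> norm (g x) \<le> c" and x: "x \<in> {-b..b}"
  shows "norm (T_f b K g x) \<le> op_norm (max_norm b) (C_space b) (T_f b K) * c"
proof -
  obtain C where C: "\<And>g x. \<lbrakk>continuous_on {-b..b} g; \<And>x. x \<in> {-b..b} \<Longrightarrow> norm (g x) \<le> 1; x \<in> {-b..b}\<rbrakk>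
    \<Longrightarrow> norm (T_f b K g x) \<le> C"
    using T_f_bounded by metis
  have "c \<ge> 0" using c[OF x] norm_ge_zero order_trans by blast
  then consider "c = 0" | "c > 0" by linarith
  then show ?thesis
  proof cases
    case 1
    then have "T_f b K g x = 0 + oint (-x) x (\<lambda>t. K x t * 0)"
      using c by (intro T_f_eq x) auto
    then show ?thesis using 1 oint_cmult[of "-x" x 0 "\<lambda>_. 0"] by simp
  next
    case 2
    define g1 where "g1 = restrict (\<lambda>t. g t / c) {-b..b}"
    have g1c: "continuous_on {-b..b} g1"
    proof (rule continuous_on_eq)
      show "continuous_on {-b..b} (\<lambda>t. g t / c)"
        using 2 by (intro continuous_intros g) auto
    qed (simp add: g1_def)
    have g1n: "norm (g1 t) \<le> 1" if "t \<in> {-b..b}" for t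
      using c[OF that] 2 that by (simp add: g1_def norm_divide)
    have "T_f b K g1 x = T_f b K g x / c"
    proof -
      have "T_f b K g1 x = g x / c + oint (-x) x (\<lambda>t. K x t * (g t / c))"
        by (intro T_f_eq x) (simp add: g1_def)
      also have "oint (-x) x (\<lambda>t. K x t * (g t / c)) = oint (-x) x (\<lambda>t. K x t * g t) / c"
        using oint_cmult[of "-x" x "1 / c" "\<lambda>t. K x t * g t"] by simp
      finally show ?thesis
        using T_f_eq[OF x, of g g] by (simp add: add_divide_distrib)
    qed
    moreover have "norm (T_f b K g1 x) \<le> max_norm b (T_f b K g1)"
      using C[OF g1c g1n] x by (rule norm_le_max_norm)
    moreover have "max_norm b (T_f b K g1) \<le> op_norm (max_norm b) (C_space b) (T_f b K)"
      unfolding op_norm_def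
    proof (intro cSUP_upper)
      show "g1 \<in> {w \<in> C_space b. max_norm b w \<le> 1}"
        using g1c g1n b_pos by (auto simp: C_space_def g1_def intro!: max_norm_le)
      show "bdd_above ((\<lambda>w. max_norm b (T_f b K w)) ` {w \<in> C_space b. max_norm b w \<le> 1})"
      proof (intro bdd_aboveI2)
        fix w assume "w \<in> {w \<in> C_space b. max_norm b w \<le> 1}"
        then have w: "continuous_on {-b..b} w" "max_norm b w \<le> 1" by (auto simp: C_space_def)
        have "norm (w x) \<le> 1" if "x \<in> {-b..b}" for x
          using norm_le_pair_norm(1)[OF w(1) w(1) that] w(2) by (simp add: pair_norm_def)
        then show "max_norm b (T_f b K w) \<le> C"
          using C[OF w(1)] b_pos by (intro max_norm_le) auto
      qed
    qed
    ultimately have "norm (T_f b K g x) / c \<le> op_norm (max_norm b) (C_space b) (T_f b K)"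
      using 2 by (simp add: norm_divide)
    then show ?thesis using 2 by (simp add: pos_divide_le_eq)
  qed
qed

text \<open>The lines \<open>t = x\<close> and \<open>t = -x\<close> are the axes
  \<open>v = 0\<close> and \<open>u = 0\<close>. The explicit formula is thus recognised as the
  restriction to the axes of a combination of transmuted functions. The primed functions stand for
  extensions of the data to the line.\<close>

lemma T_G_eq:
  assumes x: "x \<in> {-b..b}" and \<phi>: "\<And>x. x \<in> {-b..b} \<Longrightarrow> \<phi> x = \<phi>' x" and \<psi>: "\<And>x. x \<in> {-b..b} \<Longrightarrow> \<psi> x = \<psi>' x"
  shows "fst (T_G b K f (\<phi>, \<psi>)) x = transmuted \<phi>' x 0 + transmuted \<psi>' 0 x - \<phi>' 0 * f x"
    and "snd (T_G b K f (\<phi>, \<psi>)) x = transmuted \<phi>' 0 x + transmuted \<psi>' x 0 - \<phi>' 0 * f x"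
proof -
  have K: "K x (2 * t - x) = H t (x - t)" "K x (2 * t + x) = H (t + x) (- t)" for t
  proof -
    have "(x + (2 * t - x)) / 2 = t" "(x - (2 * t - x)) / 2 = x - t"
      "(x + (2 * t + x)) / 2 = t + x" "(x - (2 * t + x)) / 2 = - t"
      by (simp_all add: field_simps)
    then show "K x (2 * t - x) = H t (x - t)" "K x (2 * t + x) = H (t + x) (- t)"
      unfolding K_kernel_def by (simp_all only:)
  qed
  have I: "oint 0 x (\<lambda>t. K x (2 * t - x) * g t) = oint 0 x (\<lambda>t. H t (x - t) * g' t)"
    "oint (-x) 0 (\<lambda>t. K x (2 * t + x) * g t) = oint (-x) 0 (\<lambda>t. H (t + x) (- t) * g' t)"
    if "\<And>x. x \<in> {-b..b} \<Longrightarrow> g x = g' x" for g g'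
    unfolding K using x that by (intro oint_cong; auto simp: min_def max_def split: if_splits)+
  show "fst (T_G b K f (\<phi>, \<psi>)) x = transmuted \<phi>' x 0 + transmuted \<psi>' 0 x - \<phi>' 0 * f x"
    and "snd (T_G b K f (\<phi>, \<psi>)) x = transmuted \<phi>' 0 x + transmuted \<psi>' x 0 - \<phi>' 0 * f x"
    using x I[OF \<phi>] I[OF \<psi>] \<phi>[OF x] \<psi>[OF x] \<phi>[OF zero_mem] \<psi>[OF zero_mem]
    by (simp_all add: T_G_def transmuted_def oint_def zero_ereal_def)
qed

section \<open>\<open>T_G\<close> as a pair of decoupled Volterra equations\<close>

definition "kerA x t = 2 * H t (x - t)"
definition "kerB \<sigma> x t = \<sigma> * (2 * H (t + x) (- t))"

lemma kerA_cont: "continuous_on UNIV (\<lambda>(x, t). kerA x t)"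
  unfolding kerA_def case_prod_beta by (intro continuous_intros cont_comp2[OF H_cont])

lemma kerB_cont: "continuous_on UNIV (\<lambda>(x, t). kerB \<sigma> x t)"
  unfolding kerB_def case_prod_beta by (intro continuous_intros cont_comp2[OF H_cont])

text \<open>The components of \<open>T_G\<close> contain the same integrals with
  \<open>\<phi>\<close> and \<open>\<psi>\<close> exchanged. Hence the sum of the data meets the
  second integral with \<open>\<sigma> = 1\<close> and the difference with
  \<open>\<sigma> = -1\<close>. Removing \<open>g 0\<close> leaves an operator of the second
  kind.\<close>

lemma transmuted_volterra:
  "transmuted g x 0 + \<sigma> * (transmuted g 0 x - g 0) = g x + volterra kerA (kerB \<sigma>) g x"
  using oint_cmult[of 0 x 2 "\<lambda>t. H t (x - t) * g t"]
    oint_cmult[of "-x" 0 "\<sigma> * 2" "\<lambda>t. H (t + x) (- t) * g t"]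
  by (simp add: transmuted_def volterra_def kerA_def kerB_def mult.assoc)

lemma volterra_0 [simp]: "volterra A B g 0 = 0"
  by (simp add: volterra_def)

lemma transmuted_lin:
  assumes g: "continuous_on UNIV g" and g': "continuous_on UNIV g'"
  shows "transmuted (\<lambda>t. c * g t + d * g' t) u v = c * transmuted g u v + d * transmuted g' u v"
proof -
  have c: "continuous_on UNIV (\<lambda>r. H (r + v) (u - r) * k r)" if "continuous_on UNIV k" for k
    by (intro continuous_intros cont_comp2[OF H_cont] that)
  have "oint (-v) u (\<lambda>r. H (r + v) (u - r) * (c * g r + d * g' r)) =
    oint (-v) u (\<lambda>r. c * (H (r + v) (u - r) * g r) + d * (H (r + v) (u - r) * g' r))"
    by (simp add: algebra_simps)
  also have "\<dots> = c * oint (-v) u (\<lambda>r. H (r + v) (u - r) * g r) + d * oint (-v) u (\<lambda>r. H (r + v) (u - r) * g' r)"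
    by (simp add: oint_add c[OF g] c[OF g'] continuous_on_mult_left oint_cmult)
  finally show ?thesis by (simp add: transmuted_def algebra_simps)
qed

lemma volterra_C1:
  assumes g: "continuous_on UNIV g"
  shows "C1_on S (volterra kerA (kerB \<sigma>) g)"
proof -
  define A' where "A' = (\<lambda>x t. 2 * H\<^sub>v t (x - t))"
  define B' where "B' = (\<lambda>x t. \<sigma> * (2 * H\<^sub>u (t + x) (- t)))"
  have A': "continuous_on UNIV (\<lambda>(x, t). A' x t)" and B': "continuous_on UNIV (\<lambda>(x, t). B' x t)"
    unfolding A'_def B'_def case_prod_beta
    by (intro continuous_intros cont_comp2[OF H\<^sub>u_cont] cont_comp2[OF H\<^sub>v_cont])+
  have dA: "((\<lambda>x. kerA x t) has_vector_derivative A' x t) (at x)" for x t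
    unfolding kerA_def A'_def
    by (intro has_vector_derivative_mult_right has_vector_derivative_shift(2)[of "\<lambda>z. H t z"] deriv_H_v)
  have dB: "((\<lambda>x. kerB \<sigma> x t) has_vector_derivative B' x t) (at x)" for x t
    unfolding kerB_def B'_def
    by (intro has_vector_derivative_mult_right has_vector_derivative_shift(1)[of "\<lambda>z. H z (- t)"] deriv_H_u)
  let ?d = "\<lambda>x. kerA x x * g x + kerB \<sigma> x (-x) * g (-x) + volterra A' B' g x"
  have "continuous_on S ?d"
    by (intro continuous_intros cont_comp2[OF kerA_cont] cont_comp2[OF kerB_cont]
        volterra_cont A' B' g continuous_on_compose2[OF g] subset_UNIV)
  moreover have "(volterra kerA (kerB \<sigma>) g has_vector_derivative ?d x) (at x within S)" for x
    by (rule has_vector_derivative_at_within[OF volterra_deriv[OF kerA_cont kerB_cont A' B' dA dB g]])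
  ultimately show ?thesis
    unfolding C1_on_def by (intro exI[of _ ?d]) simp
qed

text \<open>The fixed point is at first only continuous. Written as \<open>F\<close> minus a
  Volterra integral it inherits a continuous derivative from \<open>F\<close> and from the kernels,
  and this brings the preimages under \<open>T_G\<close> into \<open>V_space\<close>.\<close>

lemma volterra_C1_solvable:
  assumes F: "C1_on {-b..b} F"
  obtains g where "continuous_on UNIV g" "C1_on {-b..b} g"
    "\<And>x. x \<in> {-b..b} \<Longrightarrow> g x + volterra kerA (kerB \<sigma>) g x = F x"
proof -
  obtain F' where F': "continuous_on UNIV F'" "\<And>x. x \<in> {-b..b} \<Longrightarrow> F' x = F x"
    using compact_extension[OF compact_Icc C1_on_imp_continuous[OF F]] by metis
  obtain g where g: "continuous_on UNIV g" "\<And>x. x \<in> {-b..b} \<Longrightarrow> g x + volterra kerA (kerB \<sigma>) g x = F' x"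
    using volterra_solvable[OF kerA_cont kerB_cont b_pos F'(1)] by metis
  have "C1_on {-b..b} (\<lambda>x. F x - volterra kerA (kerB \<sigma>) g x)"
    by (intro C1_on_diff F volterra_C1 g)
  then have "C1_on {-b..b} g"
    by (rule C1_on_cong) (use g(2) F'(2) in \<open>auto simp: algebra_simps\<close>)
  with g F'(2) show thesis by (intro that) auto
qed

text \<open>Half the sum and half the difference of \<open>s\<close> and \<open>d\<close> in the proof give the preimage: the
  sum and the difference of the two components of \<open>T\<^sub>G\<close> decouple.\<close>

lemma T_G_surj:
  assumes F1: "C1_on {-b..b} F1" and F2: "C1_on {-b..b} F2" and F0: "F1 0 = F2 0"
  obtains \<phi> \<psi> where "(\<phi>, \<psi>) \<in> V_space b"
    "T_G b K f (\<phi>, \<psi>) = (restrict F1 {-b..b}, restrict F2 {-b..b})"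
proof -
  \<comment> \<open>Besides the Volterra expression, the sum of the two components contains
    \<open>s 0 - 2 * \<phi> 0 * f x\<close> with the sought \<open>\<phi>\<close>. Both
    \<open>s 0\<close> and \<open>2 * \<phi> 0\<close> are bound to be \<open>2 * F1 0\<close>, so
    these terms go to the right side as known data.\<close>
  have "C1_on {-b..b} (\<lambda>x. F1 x + F2 x - 2 * F1 0 * (1 - f x))"
    by (intro C1_on_add C1_on_diff C1_on_cmult C1_on_const F1 F2 f_C1)
  then obtain s where s: "continuous_on UNIV s" "C1_on {-b..b} s"
    "\<And>x. x \<in> {-b..b} \<Longrightarrow> s x + volterra kerA (kerB 1) s x = F1 x + F2 x - 2 * F1 0 * (1 - f x)"
    by (rule volterra_C1_solvable[where \<sigma> = 1]) blast
  obtain d where d: "continuous_on UNIV d" "C1_on {-b..b} d"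
    "\<And>x. x \<in> {-b..b} \<Longrightarrow> d x + volterra kerA (kerB (-1)) d x = F1 x - F2 x"
    by (rule volterra_C1_solvable[OF C1_on_diff[OF F1 F2], where \<sigma> = "-1"]) blast
  have s0: "s 0 = 2 * F1 0" and d0: "d 0 = 0"
    using s(3)[OF zero_mem] d(3)[OF zero_mem] F0 f_0 by simp_all
  define \<phi> where "\<phi> = (\<lambda>x. 1/2 * s x + 1/2 * d x)"
  define \<psi> where "\<psi> = (\<lambda>x. 1/2 * s x + (-1/2) * d x)"
  have C1: "C1_on {-b..b} \<phi>" "C1_on {-b..b} \<psi>"
    unfolding \<phi>_def \<psi>_def by (intro C1_on_add C1_on_cmult s d)+
  have V: "(restrict \<phi> {-b..b}, restrict \<psi> {-b..b}) \<in> V_space b"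
    using C1 zero_mem by (simp add: V_space_def C1_space_restrict) (simp add: \<phi>_def \<psi>_def d0)
  have eq: "fst (T_G b K f (restrict \<phi> {-b..b}, restrict \<psi> {-b..b})) x = F1 x"
      "snd (T_G b K f (restrict \<phi> {-b..b}, restrict \<psi> {-b..b})) x = F2 x" if x: "x \<in> {-b..b}" for x
  proof -
    have lin: "transmuted \<phi> u v = 1/2 * transmuted s u v + 1/2 * transmuted d u v"
      "transmuted \<psi> u v = 1/2 * transmuted s u v + (-1/2) * transmuted d u v" for u v
      unfolding \<phi>_def \<psi>_def by (rule transmuted_lin s(1) d(1))+
    have "transmuted s x 0 + (transmuted s 0 x - s 0) = F1 x + F2 x - 2 * F1 0 * (1 - f x)"
      "transmuted d x 0 - (transmuted d 0 x - d 0) = F1 x - F2 x"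
      using s(3)[OF x] d(3)[OF x] transmuted_volterra[of s x 1] transmuted_volterra[of d x "-1"]
      by (simp_all add: algebra_simps)
    then have ts: "transmuted s x 0 = F1 x + F2 x + 2 * F1 0 * f x - transmuted s 0 x"
      and td: "transmuted d x 0 = F1 x - F2 x + transmuted d 0 x"
      by (simp_all add: s0 d0 algebra_simps)
    have "\<phi> 0 = F1 0" by (simp add: \<phi>_def s0 d0)
    then show "fst (T_G b K f (restrict \<phi> {-b..b}, restrict \<psi> {-b..b})) x = F1 x"
      "snd (T_G b K f (restrict \<phi> {-b..b}, restrict \<psi> {-b..b})) x = F2 x"
      using T_G_eq[OF x, of "restrict \<phi> {-b..b}" \<phi> "restrict \<psi> {-b..b}" \<psi>]
      by (simp_all add: lin ts td field_simps)
  qed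
  have "T_G b K f (restrict \<phi> {-b..b}, restrict \<psi> {-b..b}) = (restrict F1 {-b..b}, restrict F2 {-b..b})"
  proof (rule prod_eqI; rule extensionalityI[of _ "{-b..b}"])
    show "fst (T_G b K f (restrict \<phi> {-b..b}, restrict \<psi> {-b..b})) \<in> extensional {-b..b}"
      "snd (T_G b K f (restrict \<phi> {-b..b}, restrict \<psi> {-b..b})) \<in> extensional {-b..b}"
      by (simp_all add: T_G_def)
  qed (use eq in auto)
  with V that show thesis by blast
qed

lemma V_space_iff: "(\<phi>, \<psi>) \<in> V_space b \<longleftrightarrow>
    \<phi> \<in> extensional {-b..b} \<and> \<psi> \<in> extensional {-b..b} \<and> C1_on {-b..b} \<phi> \<and> C1_on {-b..b} \<psi> \<and> \<phi> 0 = \<psi> 0"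
  by (auto simp: V_space_def C1_space_def C1_on_def)

text \<open>At 0 the integrals vanish and \<open>f 0 = 1\<close>, so the first component there is
  \<open>\<phi> 0\<close>. This bounds the inhomogeneity \<open>2 * \<phi> 0 * (1 - f x)\<close> in
  the equation for the sum, and stability of the two Volterra equations does the rest.\<close>

lemma T_G_stable:
  obtains C where "\<And>\<phi> \<psi> m x. \<lbrakk>(\<phi>, \<psi>) \<in> V_space b; x \<in> {-b..b};
      \<And>x. x \<in> {-b..b} \<Longrightarrow> norm (fst (T_G b K f (\<phi>, \<psi>)) x) \<le> m;
      \<And>x. x \<in> {-b..b} \<Longrightarrow> norm (snd (T_G b K f (\<phi>, \<psi>)) x) \<le> m\<rbrakk>
    \<Longrightarrow> norm (\<phi> x) \<le> C * m \<and> norm (\<psi> x) \<le> C * m"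
proof -
  obtain C1 where C1: "C1 \<ge> 0" "\<And>g m x. \<lbrakk>continuous_on UNIV g; x \<in> {-b..b};
    \<And>x. x \<in> {-b..b} \<Longrightarrow> norm (g x + volterra kerA (kerB 1) g x) \<le> m\<rbrakk> \<Longrightarrow> norm (g x) \<le> C1 * m"
    using volterra_stable[OF kerA_cont kerB_cont b_pos] by metis
  obtain C2 where C2: "C2 \<ge> 0" "\<And>g m x. \<lbrakk>continuous_on UNIV g; x \<in> {-b..b};
    \<And>x. x \<in> {-b..b} \<Longrightarrow> norm (g x + volterra kerA (kerB (-1)) g x) \<le> m\<rbrakk> \<Longrightarrow> norm (g x) \<le> C2 * m"
    using volterra_stable[OF kerA_cont kerB_cont b_pos] by metis
  obtain M where M: "\<And>x. x \<in> {-b..b} \<Longrightarrow> norm (f x) \<le> M"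
    using compact_imp_bounded[OF compact_continuous_image[OF C1_on_imp_continuous[OF f_C1] compact_Icc]]
    unfolding bounded_iff by blast
  show thesis
  \<comment> \<open>\<open>C1 * (2 + 2 * (1 + M))\<close> belongs to the sum \<open>s\<close>,
    \<open>C2 * 2\<close> to the difference \<open>d\<close>, with \<open>M\<close> a bound for
    \<open>f\<close>; half of their total bounds each component.\<close>
  proof (rule that[of "(C1 * (2 + 2 * (1 + M)) + C2 * 2) / 2"])
    fix \<phi> \<psi> m x
    assume V: "(\<phi>, \<psi>) \<in> V_space b" and x: "x \<in> {-b..b}"
      and m: "\<And>x. x \<in> {-b..b} \<Longrightarrow> norm (fst (T_G b K f (\<phi>, \<psi>)) x) \<le> m"
        "\<And>x. x \<in> {-b..b} \<Longrightarrow> norm (snd (T_G b K f (\<phi>, \<psi>)) x) \<le> m"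
    have cont: "continuous_on {-b..b} \<phi>" "continuous_on {-b..b} \<psi>" and eq0: "\<phi> 0 = \<psi> 0"
      using V by (auto simp: V_space_iff intro: C1_on_imp_continuous)
    obtain \<phi>' where \<phi>': "continuous_on UNIV \<phi>'" "\<And>x. x \<in> {-b..b} \<Longrightarrow> \<phi>' x = \<phi> x"
      using compact_extension[OF compact_Icc cont(1)] by metis
    obtain \<psi>' where \<psi>': "continuous_on UNIV \<psi>'" "\<And>x. x \<in> {-b..b} \<Longrightarrow> \<psi>' x = \<psi> x"
      using compact_extension[OF compact_Icc cont(2)] by metis
    have T: "fst (T_G b K f (\<phi>, \<psi>)) y = transmuted \<phi>' y 0 + transmuted \<psi>' 0 y - \<phi>' 0 * f y"
      "snd (T_G b K f (\<phi>, \<psi>)) y = transmuted \<phi>' 0 y + transmuted \<psi>' y 0 - \<phi>' 0 * f y"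
      if "y \<in> {-b..b}" for y
      by (rule T_G_eq[OF that]; simp add: \<phi>'(2) \<psi>'(2))+
    have eq0': "\<psi>' 0 = \<phi>' 0" using \<phi>'(2) \<psi>'(2) eq0 zero_mem by simp
    have "norm (\<phi>' 0) \<le> m"
      using m(1)[OF zero_mem] by (simp add: T(1)[OF zero_mem] transmuted_def f_0 eq0')
    define s where "s = (\<lambda>x. 1 * \<phi>' x + 1 * \<psi>' x)"
    define d where "d = (\<lambda>x. 1 * \<phi>' x + (-1) * \<psi>' x)"
    have sc: "continuous_on UNIV s" and dc: "continuous_on UNIV d"
      unfolding s_def d_def by (intro continuous_intros \<phi>' \<psi>')+
    have lin: "transmuted s u v = transmuted \<phi>' u v + transmuted \<psi>' u v"
      "transmuted d u v = transmuted \<phi>' u v - transmuted \<psi>' u v" for u v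
      using transmuted_lin[OF \<phi>'(1) \<psi>'(1), of 1 1] transmuted_lin[OF \<phi>'(1) \<psi>'(1), of 1 "-1"]
      unfolding s_def d_def by simp_all
    have s0: "s 0 = 2 * \<phi>' 0" and d0: "d 0 = 0"
      by (simp_all add: s_def d_def eq0')
    have "norm (s x) \<le> C1 * ((2 + 2 * (1 + M)) * m)"
    proof (rule C1(2)[OF sc x])
      fix y assume y: "y \<in> {-b..b}"
      have eq: "s y + volterra kerA (kerB 1) s y =
        fst (T_G b K f (\<phi>, \<psi>)) y + snd (T_G b K f (\<phi>, \<psi>)) y - 2 * \<phi>' 0 * (1 - f y)"
        unfolding transmuted_volterra[symmetric]
        by (simp add: T[OF y] lin s0 algebra_simps)
      have "norm (s y + volterra kerA (kerB 1) s y) \<le> norm (fst (T_G b K f (\<phi>, \<psi>)) y) + norm (snd (T_G b K f (\<phi>, \<psi>)) y)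
          + norm (2 * \<phi>' 0 * (1 - f y))"
        unfolding eq by (intro order_trans[OF norm_triangle_ineq4] add_right_mono norm_triangle_ineq)
      moreover have "norm (2 * \<phi>' 0 * (1 - f y)) \<le> 2 * m * (1 + M)"
      proof -
        have "norm (1 - f y) \<le> 1 + M"
          using norm_triangle_ineq4[of 1 "f y"] M[OF y] by simp
        with \<open>norm (\<phi>' 0) \<le> m\<close> show ?thesis
          unfolding norm_mult by (intro mult_mono) (auto intro: order_trans[OF norm_ge_zero])
      qed
      ultimately show "norm (s y + volterra kerA (kerB 1) s y) \<le> (2 + 2 * (1 + M)) * m"
        using m[OF y] by (simp add: algebra_simps)
    qed
    moreover have "norm (d x) \<le> C2 * (2 * m)"
    proof (rule C2(2)[OF dc x])
      fix y assume y: "y \<in> {-b..b}"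
      have eq: "d y + volterra kerA (kerB (-1)) d y =
        fst (T_G b K f (\<phi>, \<psi>)) y - snd (T_G b K f (\<phi>, \<psi>)) y"
        unfolding transmuted_volterra[symmetric]
        by (simp add: T[OF y] lin d0 algebra_simps)
      have "norm (d y + volterra kerA (kerB (-1)) d y) \<le> norm (fst (T_G b K f (\<phi>, \<psi>)) y) + norm (snd (T_G b K f (\<phi>, \<psi>)) y)"
        unfolding eq by (rule norm_triangle_ineq4)
      then show "norm (d y + volterra kerA (kerB (-1)) d y) \<le> 2 * m"
        using m[OF y] by simp
    qed
    moreover have "2 * \<phi> x = s x + d x" "2 * \<psi> x = s x - d x"
      using \<phi>'(2)[OF x] \<psi>'(2)[OF x] by (simp_all add: s_def d_def)
    then have "2 * norm (\<phi> x) \<le> norm (s x) + norm (d x)" "2 * norm (\<psi> x) \<le> norm (s x) + norm (d x)"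
      using norm_triangle_ineq[of "s x" "d x"] norm_triangle_ineq4[of "s x" "d x"]
      by (metis norm_mult norm_numeral)+
    ultimately show "norm (\<phi> x) \<le> (C1 * (2 + 2 * (1 + M)) + C2 * 2) / 2 * m \<and>
        norm (\<psi> x) \<le> (C1 * (2 + 2 * (1 + M)) + C2 * 2) / 2 * m"
      by (simp add: algebra_simps)
  qed
qed

lemma T_G_inv_inverse:
  assumes "w \<in> V_space b"
  shows "T_G_inv b K f w \<in> V_space b" "T_G b K f (T_G_inv b K f w) = w"
proof -
  obtain w1 w2 where w: "w = (w1, w2)" by (cases w)
  have *: "w1 \<in> extensional {-b..b}" "w2 \<in> extensional {-b..b}" "C1_on {-b..b} w1" "C1_on {-b..b} w2" "w1 0 = w2 0"
    using assms by (auto simp: w V_space_iff)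
  obtain \<phi> \<psi> where "(\<phi>, \<psi>) \<in> V_space b"
    "T_G b K f (\<phi>, \<psi>) = (restrict w1 {-b..b}, restrict w2 {-b..b})"
    using T_G_surj[OF *(3-5)] .
  then have "w \<in> T_G b K f ` V_space b"
    using * by (force simp: w extensional_restrict)
  then show "T_G_inv b K f w \<in> V_space b" "T_G b K f (T_G_inv b K f w) = w"
    unfolding T_G_inv_def by (rule inv_into_into, rule f_inv_into_f)
qed

text \<open>The supremum is finite because \<open>T_G_stable\<close> with \<open>m = 1\<close>
  applies to whichever preimage \<open>inv_into\<close> selects.\<close>

lemma T_G_inv_norm_le:
  assumes w: "w \<in> V_space b" "pair_norm b w \<le> 1"
  shows "pair_norm b (T_G_inv b K f w) \<le> op_norm (pair_norm b) (V_space b) (T_G_inv b K f)"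
  unfolding op_norm_def
proof (rule cSUP_upper)
  obtain C where C: "\<And>\<phi> \<psi> m x. \<lbrakk>(\<phi>, \<psi>) \<in> V_space b; x \<in> {-b..b};
      \<And>x. x \<in> {-b..b} \<Longrightarrow> norm (fst (T_G b K f (\<phi>, \<psi>)) x) \<le> m;
      \<And>x. x \<in> {-b..b} \<Longrightarrow> norm (snd (T_G b K f (\<phi>, \<psi>)) x) \<le> m\<rbrakk>
    \<Longrightarrow> norm (\<phi> x) \<le> C * m \<and> norm (\<psi> x) \<le> C * m"
    using T_G_stable by metis
  show "bdd_above ((\<lambda>w. pair_norm b (T_G_inv b K f w)) ` {w \<in> V_space b. pair_norm b w \<le> 1})"
  proof (rule bdd_aboveI2)
    fix w assume "w \<in> {w \<in> V_space b. pair_norm b w \<le> 1}"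
    then have w: "w \<in> V_space b" "pair_norm b w \<le> 1" by auto
    obtain \<phi> \<psi> where \<phi>\<psi>: "T_G_inv b K f w = (\<phi>, \<psi>)" by (cases "T_G_inv b K f w")
    obtain w1 w2 where w12: "w = (w1, w2)" by (cases w)
    have "continuous_on {-b..b} w1" "continuous_on {-b..b} w2"
      using w(1) by (auto simp: w12 V_space_iff intro: C1_on_imp_continuous)
    from norm_le_pair_norm[OF this] w(2)
    have "norm (w1 x) \<le> 1" "norm (w2 x) \<le> 1" if "x \<in> {-b..b}" for x
      using that by (fastforce simp: w12)+
    moreover have "(\<phi>, \<psi>) \<in> V_space b" "T_G b K f (\<phi>, \<psi>) = (w1, w2)"
      using T_G_inv_inverse[OF w(1)] unfolding \<phi>\<psi> by (simp_all add: w12)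
    ultimately have "norm (\<phi> x) \<le> C * 1 \<and> norm (\<psi> x) \<le> C * 1" if "x \<in> {-b..b}" for x
      using that by (intro C) auto
    then show "pair_norm b (T_G_inv b K f w) \<le> C"
      unfolding \<phi>\<psi> pair_norm_def using b_pos by (auto intro!: max_norm_le)
  qed
qed (use w in auto)

lemma goursat_estimate:
  assumes D: "wave_sol b q D"
    and C1: "C1_on {-b..b} (\<lambda>x. D x 0)" "C1_on {-b..b} (\<lambda>x. D 0 x)"
    and le1: "\<And>x. x \<in> {-b..b} \<Longrightarrow> norm (D x 0) \<le> 1" "\<And>x. x \<in> {-b..b} \<Longrightarrow> norm (D 0 x) \<le> 1"
    and xt: "x \<in> {-b..b}" "t \<in> {-b..b}"
  shows "norm (D ((x + t) / 2) ((x - t) / 2)) \<le> 3 * op_norm (max_norm b) (C_space b) (T_f b K)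
    * op_norm (pair_norm b) (V_space b) (T_G_inv b K f)"
proof -
  define w where "w = (restrict (\<lambda>x. D x 0) {-b..b}, restrict (\<lambda>x. D 0 x) {-b..b})"
  have w: "w \<in> V_space b"
    using C1 zero_mem unfolding w_def V_space_def by (simp add: C1_space_restrict)
  have wn: "pair_norm b w \<le> 1"
    using le1 b_pos by (auto simp: w_def pair_norm_def intro!: max_norm_le)
  obtain \<phi> \<psi> where \<phi>\<psi>: "T_G_inv b K f w = (\<phi>, \<psi>)" by (cases "T_G_inv b K f w")
  have V: "(\<phi>, \<psi>) \<in> V_space b" and TG: "T_G b K f (\<phi>, \<psi>) = w"
    using T_G_inv_inverse[OF w] by (simp_all add: \<phi>\<psi>)
  define c where "c = op_norm (pair_norm b) (V_space b) (T_G_inv b K f)"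
  have cont: "continuous_on {-b..b} \<phi>" "continuous_on {-b..b} \<psi>"
    using V by (auto simp: V_space_iff intro: C1_on_imp_continuous)
  have le: "norm (\<phi> x) \<le> c" "norm (\<psi> x) \<le> c" if "x \<in> {-b..b}" for x
    using norm_le_pair_norm[OF cont that] T_G_inv_norm_le[OF w wn] unfolding \<phi>\<psi> c_def[symmetric] by linarith+
  obtain \<phi>' where \<phi>': "continuous_on UNIV \<phi>'" "\<And>x. x \<in> {-b..b} \<Longrightarrow> \<phi>' x = \<phi> x"
    using compact_extension[OF compact_Icc cont(1)] by metis
  obtain \<psi>' where \<psi>': "continuous_on UNIV \<psi>'" "\<And>x. x \<in> {-b..b} \<Longrightarrow> \<psi>' x = \<psi> x"
    using compact_extension[OF compact_Icc cont(2)] by metis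
  \<comment> \<open>The extension is merely continuous on the line. Its differentiability inside the
    interval comes from \<open>V_space\<close> and is what \<open>wave_sol_transmuted_swap\<close>
    asks for.\<close>
  have "C1_on {-b..b} \<psi>'"
    using V by (auto simp: V_space_iff \<psi>'(2) intro: C1_on_cong)
  then obtain d where d: "\<And>x. x \<in> {-b..b} \<Longrightarrow> (\<psi>' has_vector_derivative d x) (at x within {-b..b})"
    unfolding C1_on_def by blast
  have d': "(\<psi>' has_vector_derivative d x) (at x)" if "\<bar>x\<bar> < b" for x
    using d[of x] that at_within_interior[of x "{-b..b}"] by (simp add: abs_less_iff)
  define W where "W = (\<lambda>u v. transmuted \<phi>' u v + transmuted \<psi>' v u - \<phi>' 0 * transmuted (\<lambda>_. 1) u v)"
  have W: "wave_sol b q W"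
    unfolding W_def
    by (intro wave_sol_diff wave_sol_add wave_sol_cmult wave_sol_transmuted wave_sol_transmuted_swap[OF _ d']
        \<phi>' \<psi>' continuous_intros)
  have "D u v - W u v = 0" if "(u, v) \<in> diamond b" for u v
  proof (rule wave_sol_unique_zero[OF b_pos continuous_on_subset[OF q_cont] wave_sol_diff[OF D W] _ _ that])
    fix x assume x: "x \<in> {-b..b}"
    show "D x 0 - W x 0 = 0" "D 0 x - W 0 x = 0"
      using T_G_eq[of x \<phi> \<phi>' \<psi> \<psi>'] \<phi>'(2) \<psi>'(2) x transmuted_one[OF x]
      unfolding TG by (simp_all add: w_def W_def)
  qed simp
  moreover have "((x + t) / 2, (x - t) / 2) \<in> diamond b"
    using xt by (rule half_coords_in_diamond)
  ultimately have eq: "D ((x + t) / 2) ((x - t) / 2) = W ((x + t) / 2) ((x - t) / 2)"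
    by fastforce
  \<comment> \<open>For fixed \<open>t\<close> this is the wave function
    \<open>s \<mapsto> w (s, t)\<close> to which \<open>T_f\<close> is applied. The forms
    \<open>s + (-t)\<close> and \<open>* 1\<close> match the instances of
    \<open>kernel_transmuted\<close> used below.\<close>
  define g where "g = (\<lambda>s. \<phi>' ((s + t) / 2) + \<psi>' ((s + (-t)) / 2) - \<phi>' 0 * 1)"
  have gc: "continuous_on UNIV g"
    unfolding g_def by (intro continuous_intros continuous_on_compose2[OF \<phi>'(1)] continuous_on_compose2[OF \<psi>'(1)] subset_UNIV) auto
  have "W ((x + t) / 2) ((x - t) / 2) = g x + oint (-x) x (\<lambda>s. K x s * g s)"
  proof -
    have Kc: "continuous_on UNIV (\<lambda>s. K x s * k s)" if "continuous_on UNIV k" for k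
      by (intro continuous_intros cont_comp2[OF K_cont] that)
    have 1: "continuous_on UNIV (\<lambda>s. \<phi>' ((s + t) / 2))" "continuous_on UNIV (\<lambda>s. \<psi>' ((s + (-t)) / 2))"
      by (intro continuous_intros continuous_on_compose2[OF \<phi>'(1)] continuous_on_compose2[OF \<psi>'(1)] subset_UNIV; simp)+
    have I: "oint (-x) x (\<lambda>s. K x s * g s) = oint (-x) x (\<lambda>s. K x s * \<phi>' ((s + t) / 2))
      + oint (-x) x (\<lambda>s. K x s * \<psi>' ((s + (-t)) / 2)) - \<phi>' 0 * oint (-x) x (\<lambda>s. K x s * 1)"
    proof -
      have "(\<lambda>s. K x s * g s) = (\<lambda>s. (K x s * \<phi>' ((s + t) / 2) + K x s * \<psi>' ((s + (-t)) / 2)) - \<phi>' 0 * (K x s * 1))"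
        by (simp add: g_def algebra_simps)
      then show ?thesis
        by (simp only: oint_diff[OF continuous_on_add[OF Kc[OF 1(1)] Kc[OF 1(2)]]
            continuous_on_mult_left[OF Kc[OF continuous_on_const]]] oint_add[OF Kc[OF 1(1)] Kc[OF 1(2)]] oint_cmult)
    qed
    have k: "transmuted \<phi>' ((x + t) / 2) ((x - t) / 2) =
        \<phi>' ((x + t) / 2) + oint (-x) x (\<lambda>s. K x s * \<phi>' ((s + t) / 2))"
      "transmuted \<psi>' ((x - t) / 2) ((x + t) / 2) =
        \<psi>' ((x + (-t)) / 2) + oint (-x) x (\<lambda>s. K x s * \<psi>' ((s + (-t)) / 2))"
      "transmuted (\<lambda>_. 1) ((x + t) / 2) ((x - t) / 2) = 1 + oint (-x) x (\<lambda>s. K x s * 1)"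
      using kernel_transmuted[OF \<phi>'(1), of x t] kernel_transmuted[OF \<psi>'(1), of x "-t"]
        kernel_transmuted[OF continuous_on_const, of 1 x t] by simp_all
    show ?thesis
      unfolding W_def k I by (simp add: g_def algebra_simps)
  qed
  also have "\<dots> = T_f b K g x"
    by (rule T_f_eq[OF xt(1), symmetric]) simp
  also have "norm \<dots> \<le> op_norm (max_norm b) (C_space b) (T_f b K) * (c + c + c)"
  proof (rule T_f_norm_le[OF continuous_on_subset[OF gc] _ xt(1)])
    fix s assume s: "s \<in> {-b..b}"
    have mem: "(s + t) / 2 \<in> {-b..b}" "(s + (-t)) / 2 \<in> {-b..b}"
      using s xt by auto
    have "norm (g s) \<le> norm (\<phi>' ((s + t) / 2)) + norm (\<psi>' ((s + (-t)) / 2)) + norm (\<phi>' 0 * 1)"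
      unfolding g_def by (intro order_trans[OF norm_triangle_ineq4] add_right_mono norm_triangle_ineq)
    also have "\<dots> \<le> c + c + c"
      using mem zero_mem le by (intro add_mono) (simp_all only: \<phi>'(2) \<psi>'(2) mult_1_right)
    finally show "norm (g s) \<le> c + c + c" .
  qed simp
  finally show ?thesis
    unfolding eq c_def by (simp add: algebra_simps)
qed

end

section \<open>The error estimate\<close>

text \<open>The parity in \<open>t\<close> explains the hypotheses of the theorem. The kernel has
  the values \<open>h / 2 + 1 / 2 * oint 0 x q\<close> and \<open>h / 2\<close> on the two
  diagonals; their half-sum is to be matched by the even polynomials and their half-difference by
  the odd ones, whence the factors 1/4.\<close>

lemma K_approx_traces:
  "K_approx f N \<alpha> \<beta> x x = (\<Sum>n=0..N. \<alpha> n * c_trace f n x) + (\<Sum>n=1..N. \<beta> n * s_trace f n x)"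
  "K_approx f N \<alpha> \<beta> x (- x) = (\<Sum>n=0..N. \<alpha> n * c_trace f n x) - (\<Sum>n=1..N. \<beta> n * s_trace f n x)"
proof -
  have "(\<Sum>n=1..N. \<beta> n * s_trace f n x) = (\<Sum>n=1..N. \<beta> n * half_wave_poly f True n x x)"
    by (intro sum.cong) (auto simp: s_trace_eq)
  then show "K_approx f N \<alpha> \<beta> x x = (\<Sum>n=0..N. \<alpha> n * c_trace f n x) + (\<Sum>n=1..N. \<beta> n * s_trace f n x)"
    "K_approx f N \<alpha> \<beta> x (- x) = (\<Sum>n=0..N. \<alpha> n * c_trace f n x) - (\<Sum>n=1..N. \<beta> n * s_trace f n x)"
    by (simp_all add: K_approx_eq c_trace_eq half_wave_poly_uminus sum_negf)
qed

text \<open>The estimate is obtained for the extended kernel. Operators that see the kernel on the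
  square only are the same for the given one.\<close>

lemma T_f_cong:
  assumes "\<And>x t. x \<in> {-b..b} \<Longrightarrow> t \<in> {-b..b} \<Longrightarrow> K x t = K' x t"
  shows "T_f b K = T_f b K'"
proof (intro ext)
  fix u x
  show "T_f b K u x = T_f b K' u x"
  proof (cases "x \<in> {-b..b}")
    case True
    then have "oint (-x) x (\<lambda>t. K x t * u t) = oint (-x) x (\<lambda>t. K' x t * u t)"
      using assms by (intro oint_cong) (auto simp: min_def max_def split: if_splits)
    with True show ?thesis by (simp add: T_f_def oint_def)
  qed (auto simp: T_f_def restrict_def)
qed

text \<open>For \<open>t\<close> between \<open>0\<close> and \<open>x\<close> the argument
  \<open>2 * t - x\<close> stays between \<open>-x\<close> and \<open>x\<close>, and so does
  \<open>2 * t + x\<close> for \<open>t\<close> between \<open>-x\<close> and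
  \<open>0\<close>.\<close>

lemma T_G_cong:
  assumes "\<And>x t. x \<in> {-b..b} \<Longrightarrow> t \<in> {-b..b} \<Longrightarrow> K x t = K' x t"
  shows "T_G b K f = T_G b K' f"
proof (intro ext)
  fix w :: "(real \<Rightarrow> complex) \<times> (real \<Rightarrow> complex)"
  obtain \<phi> \<psi> where w: "w = (\<phi>, \<psi>)" by (cases w)
  have "oint 0 x (\<lambda>t. K x (2 * t - x) * g t) = oint 0 x (\<lambda>t. K' x (2 * t - x) * g t)"
    "oint (-x) 0 (\<lambda>t. K x (2 * t + x) * g t) = oint (-x) 0 (\<lambda>t. K' x (2 * t + x) * g t)"
    if x: "x \<in> {-b..b}" for x g
    using x by (intro oint_cong, subst assms; auto simp: min_def max_def split: if_splits)+
  then show "T_G b K f w = T_G b K' f w"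
    by (auto simp: T_G_def w oint_def zero_ereal_def intro!: restrict_ext)
qed

theorem theorem5p1:
  fixes b :: real
    and q f f' f'' :: "real \<Rightarrow> complex"
    and h :: complex
    and H :: "real \<Rightarrow> real \<Rightarrow> complex"
    and N :: nat
    and \<alpha> \<beta> :: "nat \<Rightarrow> complex"
    and \<epsilon>\<^sub>1 \<epsilon>\<^sub>2 :: real
  assumes b_pos: "b > 0"
    and q_cont: "continuous_on {-b..b} q"
    and f_deriv: "\<And>x. x \<in> {-b..b} \<Longrightarrow> (f has_vector_derivative f' x) (at x within {-b..b})"
    and f_deriv2: "\<And>x. x \<in> {-b..b} \<Longrightarrow> (f' has_vector_derivative f'' x) (at x within {-b..b})"
    and f_C2: "continuous_on {-b..b} f''"
    and f_ode: "\<And>x. x \<in> {-b..b} \<Longrightarrow> f'' x - q x * f x = 0"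
    and f_nz: "\<And>x. x \<in> {-b..b} \<Longrightarrow> f x \<noteq> 0"
    and f_0: "f 0 = 1"
    and h_def: "h = f' 0"
    and H_sol: "goursat_solution b q h H"
    and approx1: "\<And>x. x \<in> {-b..b} \<Longrightarrow>
      norm (h / 2 + 1 / 4 * (LBINT s=0..x. q s) - (\<Sum>n=0..N. \<alpha> n * c_trace f n x)) < \<epsilon>\<^sub>1"
    and approx2: "\<And>x. x \<in> {-b..b} \<Longrightarrow>
      norm (1 / 4 * (LBINT s=0..x. q s) - (\<Sum>n=1..N. \<beta> n * s_trace f n x)) < \<epsilon>\<^sub>2"
  shows "\<forall>x\<in>{-b..b}. \<forall>t\<in>{-b..b}.
    norm (K_kernel H x t - K_approx f N \<alpha> \<beta> x t)
      \<le> 3 * op_norm (max_norm b) (C_space b) (T_f b (K_kernel H))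
          * op_norm (pair_norm b) (V_space b) (T_G_inv b (K_kernel H) f)
          * (\<epsilon>\<^sub>1 + \<epsilon>\<^sub>2)"
proof -
  obtain q' H' H\<^sub>u H\<^sub>v G where gk: "goursat_kernel b q' h H' H\<^sub>u H\<^sub>v G"
    and q': "\<And>x. x \<in> {-b..b} \<Longrightarrow> q' x = q x" and H': "\<And>u v. (u, v) \<in> diamond b \<Longrightarrow> H' u v = H u v"
    using goursat_extension[OF b_pos q_cont H_sol] by metis
  interpret goursat_kernel b q' h H' H\<^sub>u H\<^sub>v G by (rule gk)
  have "(f' has_vector_derivative q' x * f x) (at x within {-b..b})" if "x \<in> {-b..b}" for x
    using f_deriv2[OF that] f_ode[OF that] q'[OF that] by simp
  then interpret transmutation b q' h H' H\<^sub>u H\<^sub>v G f f'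
    by unfold_locales (use b_pos f_deriv f_nz f_0 h_def in auto)
  have K: "K_kernel H x t = K_kernel H' x t" if "x \<in> {-b..b}" "t \<in> {-b..b}" for x t
    using H'[OF half_coords_in_diamond[OF that]] by (simp add: K_kernel_def)
  define \<epsilon> where "\<epsilon> = \<epsilon>\<^sub>1 + \<epsilon>\<^sub>2"
  \<comment> \<open>The strict inequalities at 0 force both bounds to be positive, so division by
    \<open>\<epsilon>\<close> is legitimate.\<close>
  have \<epsilon>: "\<epsilon> > 0"
    using approx1[OF zero_mem] approx2[OF zero_mem] unfolding \<epsilon>_def
    by (meson add_pos_pos le_less_trans norm_ge_zero)
  \<comment> \<open>Normalised to data in the unit ball, so that linearity of \<open>T_G_inv\<close> is not needed.\<close>
  define D where "D = (\<lambda>u v. of_real (1 / \<epsilon>) * (H' u v - K_approx f N \<alpha> \<beta> (u + v) (u - v)))"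
  have "wave_sol b q' H'"
  proof (rule wave_solI[OF _ deriv_H_v])
    show "continuous_on (diamond b) (\<lambda>(u, v). H' u v)"
      by (rule continuous_on_subset[OF H_cont subset_UNIV])
    show "((\<lambda>y. H\<^sub>v y v) has_vector_derivative q' (u + v) * H' u v) (at u)" if "\<bar>u\<bar> + \<bar>v\<bar> < b" for u v
      using deriv_H\<^sub>v_u[of v u] G_eq[of u v] that by (simp add: diamond_iff)
  qed
  then have D: "wave_sol b q' D"
    unfolding D_def
    by (intro wave_sol_cmult wave_sol_diff wave_sol_K_approx)
  have "C1_on {-b..b} (\<lambda>x. oint 0 x q')"
    unfolding C1_on_def
    by (intro exI[of _ q']) (auto intro!: oint_deriv continuous_on_subset[OF goursat_kernel.q_cont[OF gk]]
        goursat_kernel.q_cont[OF gk])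
  then have C1: "C1_on {-b..b} (\<lambda>x. D x 0)" "C1_on {-b..b} (\<lambda>x. D 0 x)"
    unfolding D_def H_u0 H_0v add_0_left add_0_right diff_0 diff_0_right
    by (intro C1_on_cmult C1_on_diff C1_on_add C1_on_const K_approx_C1; assumption)+
  have le1: "norm (D x 0) \<le> 1" "norm (D 0 x) \<le> 1" if x: "x \<in> {-b..b}" for x
  proof -
    define A where "A = h / 2 + 1 / 4 * (LBINT s=0..x. q s) - (\<Sum>n=0..N. \<alpha> n * c_trace f n x)"
    define B where "B = 1 / 4 * (LBINT s=0..x. q s) - (\<Sum>n=1..N. \<beta> n * s_trace f n x)"
    have "oint 0 x q' = oint 0 x q"
      using x q' by (intro oint_cong) (auto simp: min_def max_def split: if_splits)
    then have "oint 0 x q' = (LBINT s=0..x. q s)"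
      by (simp add: oint_def zero_ereal_def)
    then have "H' x 0 - K_approx f N \<alpha> \<beta> x x = A + B" "H' 0 x - K_approx f N \<alpha> \<beta> x (- x) = A - B"
      by (simp_all add: H_u0 H_0v K_approx_traces A_def B_def)
    then have "D x 0 = (A + B) / \<epsilon>" "D 0 x = (A - B) / \<epsilon>"
      by (simp_all add: D_def)
    moreover have "norm A + norm B \<le> \<epsilon>"
      using approx1[OF x] approx2[OF x] unfolding A_def B_def \<epsilon>_def by linarith
    then have "norm (A + B) \<le> \<epsilon>" "norm (A - B) \<le> \<epsilon>"
      using norm_triangle_ineq[of A B] norm_triangle_ineq4[of A B] by linarith+
    ultimately show "norm (D x 0) \<le> 1" "norm (D 0 x) \<le> 1"
      using \<epsilon> by (simp_all add: norm_divide)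
  qed
  show ?thesis
  proof (intro ballI)
    fix x t assume xt: "x \<in> {-b..b}" "t \<in> {-b..b}"
    have coords: "(x + t) / 2 + (x - t) / 2 = x" "(x + t) / 2 - (x - t) / 2 = t"
      by (simp_all add: field_simps)
    have "D ((x + t) / 2) ((x - t) / 2) = of_real (1 / \<epsilon>) * (K_kernel H x t - K_approx f N \<alpha> \<beta> x t)"
      unfolding D_def coords K[OF xt] by (simp add: K_kernel_def)
    then have "norm (K_kernel H x t - K_approx f N \<alpha> \<beta> x t) = norm (D ((x + t) / 2) ((x - t) / 2)) * \<epsilon>"
      using \<epsilon> by (simp add: norm_divide)
    also have "\<dots> \<le> 3 * op_norm (max_norm b) (C_space b) (T_f b (K_kernel H'))
          * op_norm (pair_norm b) (V_space b) (T_G_inv b (K_kernel H') f) * \<epsilon>"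
      using \<epsilon> by (intro mult_right_mono goursat_estimate D C1 le1 xt) auto
    also have "T_f b (K_kernel H') = T_f b (K_kernel H)"
      by (rule T_f_cong) (simp add: K)
    also have "T_G_inv b (K_kernel H') f = T_G_inv b (K_kernel H) f"
      unfolding T_G_inv_def by (rule arg_cong[of _ _ "inv_into (V_space b)"], rule T_G_cong) (simp add: K)
    finally show "norm (K_kernel H x t - K_approx f N \<alpha> \<beta> x t)
      \<le> 3 * op_norm (max_norm b) (C_space b) (T_f b (K_kernel H))
          * op_norm (pair_norm b) (V_space b) (T_G_inv b (K_kernel H) f) * (\<epsilon>\<^sub>1 + \<epsilon>\<^sub>2)"
      unfolding \<epsilon>_def .
  qed
qed

end
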